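(* Let $q\in(0,1)$. There exist constants $C'_q>0$, $C_q>c_q>0$ and $c>0$, depending only on $q$, such that the following holds. Let $m,n\in\mathbb{N}$ satisfy \[ m\le n\le \exp\big(C'_q\sqrt{m}\big), \] and let $A$ be an $m\times n$ matrix with independent Bernoulli$(q)$ entries. Then with probability at least $1-\exp(-m\log n)$, all $m\times m$ submatrices of $A$ have rank greater than $m-C_q\log n$. Furthermore, if $n\ge m^2$, then with probability at least $1-\exp(-cm)$ there exists a set $S\subset[n]$ with $|S|=m$ such that the $m\times m$ submatrix $A|_S$ satisfies \[ \operatorname{rank}(A|_S)\le m-c_q\log n. \]
   Context: $[n]=\{1,\dots,n\}$. For $S\subset[n]$, $A|_S$ denotes the submatrix of $A$ formed by the columns with indices in $S$; the $m\times m$ submatrices of the $m\times n$ matrix $A$ are the matrices $A|_S$ with $|S|=m$. A Bernoulli$(q)$ random variable takes the value $1$ with probability $q$ and $0$ with probability $1-q$. *)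

theory Defs
  imports
    "HOL-Probability.Product_PMF"
    "Jordan_Normal_Form.DL_Rank"
    "Jordan_Normal_Form.DL_Submatrix"
begin

text \<open>
  The law of a random real \<open>m \<times> n\<close> matrix with independent Bernoulli(\<open>q\<close>) entries.  Rows and
  columns are indexed from \<open>0\<close>.
\<close>

definition bernoulli_mat :: "real \<Rightarrow> nat \<Rightarrow> nat \<Rightarrow> real mat pmf" where
  "bernoulli_mat q m n =
     map_pmf (\<lambda>f. Matrix.mat m n (\<lambda>ij. of_bool (f ij)))
       (Pi_pmf ({..<m} \<times> {..<n}) False (\<lambda>_. bernoulli_pmf q))"

definition column_submatrix :: "'a mat \<Rightarrow> nat set \<Rightarrow> 'a mat" where
  "column_submatrix A S = submatrix A {..<dim_row A} S"

end

theory Submission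
  imports Defs "HOL-Library.Real_Mod"
begin

text \<open>
  Upper bound on the corank: by a union bound over \<open>S\<close> it suffices to show that a square
  Bernoulli matrix has corank at least \<open>k\<close> with probability at most \<open>exp (- c k m)\<close>, for all
  large \<open>k\<close> and \<open>m\<close>.  Let \<open>V\<close> be the span of the columns and let \<open>X\<close> be one column.  If
  \<open>P(X \<in> V)\<close> is exponentially small, then \<open>k\<close> columns that depend on the remaining ones already
  give the bound.  Otherwise compare \<open>X\<close> with a lazy sign vector \<open>Y\<close>.  Write \<open>V\<close> as the kernel of
  an integer matrix with \<open>d \<ge> k\<close> rows that are independent modulo 2 and express \<open>P(X \<in> V)\<close> by
  Fourier inversion modulo \<open>2M\<close>.  As the characteristic function of \<open>X\<close> at \<open>t\<close> is dominated by the
  one of \<open>Y\<close> at \<open>2t\<close>, and as doubling the frequency is a \<open>2^d\<close>-to-one map, this gives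
  \<open>P(X \<in> V) \<le> 2^(1 - d) H P(Y \<in> V)\<close>, where \<open>H\<close> counts the sparse vectors that annihilate \<open>V\<close>
  modulo 2.  Many such vectors exist only with probability \<open>exp (- c k m)\<close>, by a union bound.  In
  the remaining case, the replacement argument of Kahn, Komlos and Szemeredi exchanges \<open>m / 2\<close> of
  the columns by copies of \<open>Y\<close>, each of which gains a factor exponentially small in \<open>k\<close>.

  Lower bound on the corank: of at least \<open>m^2\<close> columns, with high probability at least \<open>m\<close> vanish
  in each of the first \<open>c0 ln n\<close> rows.
\<close>

section \<open>Integer linear algebra\<close>

definition ip :: "nat \<Rightarrow> (nat \<Rightarrow> int) \<Rightarrow> (nat \<Rightarrow> int) \<Rightarrow> int" where
  "ip m u x = (\<Sum>i<m. u i * x i)"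

definition ann :: "nat \<Rightarrow> (nat \<Rightarrow> int) set \<Rightarrow> (nat \<Rightarrow> int) set" where
  "ann m S = {u. \<forall>a\<in>S. ip m u a = 0}"

text \<open>
  As a double annihilator over the integers, \<open>cl m S\<close> is the set of integer vectors in the rational
  span of \<open>S\<close>; coordinates from \<open>m\<close> on are ignored.
\<close>

definition cl :: "nat \<Rightarrow> (nat \<Rightarrow> int) set \<Rightarrow> (nat \<Rightarrow> int) set" where
  "cl m S = {x. \<forall>u\<in>ann m S. ip m u x = 0}"

lemma ip_diff: "ip m (\<lambda>i. u i - v i) x = ip m u x - ip m v x"
  by (simp add: ip_def algebra_simps sum_subtractf)

lemma ip_scale: "ip m (\<lambda>i. c * u i) x = c * ip m u x"
  by (simp add: ip_def algebra_simps sum_distrib_left)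

lemma ip_sum: "ip m (\<lambda>i. \<Sum>p\<in>P. c p * b p i) x = (\<Sum>p\<in>P. c p * ip m (b p) x)"
proof -
  have "ip m (\<lambda>i. \<Sum>p\<in>P. c p * b p i) x = (\<Sum>i<m. \<Sum>p\<in>P. c p * (b p i * x i))"
    by (simp add: ip_def sum_distrib_right mult.assoc)
  also have "\<dots> = (\<Sum>p\<in>P. \<Sum>i<m. c p * (b p i * x i))" by (rule sum.swap)
  finally show ?thesis by (simp add: ip_def sum_distrib_left)
qed

lemma ip_cong: "(\<And>i. i < m \<Longrightarrow> u i = v i) \<Longrightarrow> ip m u x = ip m v x"
  by (simp add: ip_def)

lemma cl_superset: "S \<subseteq> cl m S"
  by (auto simp: cl_def ann_def)

lemma cl_mono: "S \<subseteq> T \<Longrightarrow> cl m S \<subseteq> cl m T"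
  by (auto simp: cl_def ann_def)

lemma cl_subset: "S \<subseteq> cl m T \<Longrightarrow> cl m S \<subseteq> cl m T"
  unfolding cl_def ann_def by blast

text \<open>Division-free elimination: if \<open>v\<close> annihilates \<open>S\<close> but not
  \<open>a\<close>, then (v.b) u - (u.b) v annihilates \<open>b\<close> and \<open>S\<close>, hence
  also \<open>a\<close>; with u.a = 0 this forces u.b = 0.\<close>

lemma cl_exchange:
  assumes "a \<in> cl m (insert b S)" "a \<notin> cl m S"
  shows "b \<in> cl m (insert a S)"
  unfolding cl_def
proof safe
  fix u assume u: "u \<in> ann m (insert a S)"
  obtain v where v: "v \<in> ann m S" "ip m v a \<noteq> 0" using assms(2) by (auto simp: cl_def)
  have "(\<lambda>i. ip m v b * u i - ip m u b * v i) \<in> ann m (insert b S)"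
    using u v by (auto simp: ann_def ip_diff ip_scale)
  then have "ip m v b * ip m u a - ip m u b * ip m v a = 0"
    using assms(1) by (auto simp: cl_def ip_diff ip_scale)
  with u v show "ip m u b = 0" by (simp add: ann_def)
qed

text \<open>When the members of the family are removed one at a time, \<open>y\<close> leaves the
  closure at some point; the member whose removal causes this can be exchanged with
  \<open>y\<close>.\<close>

lemma cl_exchange_family:
  assumes "finite J" "y \<in> cl m (Z \<union> X ` J)" "y \<notin> cl m Z"
  shows "\<exists>j\<in>J. X j \<in> cl m (insert y (Z \<union> X ` (J - {j})))"
  using assms
proof (induction J rule: finite_induct)
  case (insert j J)
  show ?case
  proof (cases "y \<in> cl m (Z \<union> X ` J)")
    case True
    then obtain i where i: "i \<in> J" "X i \<in> cl m (insert y (Z \<union> X ` (J - {i})))"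
      using insert by blast
    then have "X i \<in> cl m (insert y (Z \<union> X ` (insert j J - {i})))"
      using cl_mono[of "insert y (Z \<union> X ` (J - {i}))" "insert y (Z \<union> X ` (insert j J - {i}))" m] by blast
    then show ?thesis using i by blast
  next
    case False
    have "y \<in> cl m (insert (X j) (Z \<union> X ` J))" using insert.prems(1) by simp
    then have "X j \<in> cl m (insert y (Z \<union> X ` J))" using False by (rule cl_exchange)
    moreover have "insert j J - {j} = J" using insert.hyps by auto
    ultimately show ?thesis by auto
  qed
qed simp

text \<open>Independence is a property of the indexed family, so a repeated vector makes it
  dependent. Random vectors that happen to coincide are thus covered.\<close>

definition indep_family :: "nat \<Rightarrow> nat \<Rightarrow> (nat \<Rightarrow> nat \<Rightarrow> int) \<Rightarrow> bool" where
  "indep_family m s Y \<longleftrightarrow> (\<forall>j<s. Y j \<notin> cl m (Y ` ({..<s} - {j})))"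

text \<open>The vectors of \<open>Y\<close> are inserted one by one, each displacing one index of
  \<open>S\<close>. Independence of \<open>Y\<close> ensures that an index of \<open>S\<close> can
  be displaced each time. The size is given as a sum to avoid truncated subtraction.\<close>

lemma steinitz_exchange:
  assumes "finite S" "indep_family m s Y" "Y ` {..<s} \<subseteq> cl m (X ` S)"
  shows "\<exists>J\<subseteq>S. card J + s = card S \<and> X ` S \<subseteq> cl m (Y ` {..<s} \<union> X ` J)"
proof -
  have "\<exists>J\<subseteq>S. card J + t = card S \<and> X ` S \<subseteq> cl m (Y ` {..<t} \<union> X ` J)" if "t \<le> s" for t
    using that
  proof (induction t)
    case 0
    then show ?case using cl_superset by (intro exI[of _ S]) auto
  next
    case (Suc t)
    then obtain J where J: "J \<subseteq> S" "card J + t = card S" "X ` S \<subseteq> cl m (Y ` {..<t} \<union> X ` J)"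
      by auto
    have fin: "finite J" using J assms finite_subset by blast
    have "Y t \<notin> cl m (Y ` ({..<s} - {t}))" using assms(2) Suc.prems by (auto simp: indep_family_def)
    moreover have "cl m (Y ` {..<t}) \<subseteq> cl m (Y ` ({..<s} - {t}))" using Suc.prems by (intro cl_mono) auto
    ultimately have n: "Y t \<notin> cl m (Y ` {..<t})" by auto
    have "Y t \<in> cl m (X ` S)" using assms(3) Suc.prems by auto
    then have "Y t \<in> cl m (Y ` {..<t} \<union> X ` J)" using cl_subset[OF J(3)] by auto
    from cl_exchange_family[OF fin this n] obtain j where j: "j \<in> J"
      "X j \<in> cl m (insert (Y t) (Y ` {..<t} \<union> X ` (J - {j})))" by auto
    have e: "insert (Y t) (Y ` {..<t} \<union> X ` (J - {j})) = Y ` {..<Suc t} \<union> X ` (J - {j})"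
      by (auto simp: lessThan_Suc)
    have "Y ` {..<t} \<union> X ` J \<subseteq> cl m (Y ` {..<Suc t} \<union> X ` (J - {j}))"
      using j(2)[unfolded e] cl_superset[of "Y ` {..<Suc t} \<union> X ` (J - {j})" m] by auto
    then have "X ` S \<subseteq> cl m (Y ` {..<Suc t} \<union> X ` (J - {j}))"
      using J(3) cl_subset by blast
    moreover have "card (J - {j}) + Suc t = card S" using j J(2) fin card_Suc_Diff1[OF fin j(1)] by simp
    ultimately show ?case using J(1) by (intro exI[of _ "J - {j}"]) auto
  qed
  from this[of s] show ?thesis by simp
qed

section \<open>Integer echelon forms\<close>

lemma homogeneous_system:
  fixes S :: "(nat \<Rightarrow> int) set"
  assumes "finite S" "finite I" "card S < card I"
  shows "\<exists>u. (\<exists>i\<in>I. u i \<noteq> 0) \<and> (\<forall>i. i \<notin> I \<longrightarrow> u i = 0) \<and> (\<forall>a\<in>S. (\<Sum>i\<in>I. u i * a i) = 0)"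
  using assms
proof (induction S arbitrary: I rule: finite_induct)
  case empty
  then obtain i where "i \<in> I" by fastforce
  then show ?case by (intro exI[of _ "\<lambda>j. if j = i then 1 else 0"]) auto
next
  case (insert f S)
  obtain u where u: "\<exists>i\<in>I. u i \<noteq> 0" "\<forall>i. i \<notin> I \<longrightarrow> u i = 0" "\<forall>a\<in>S. (\<Sum>i\<in>I. u i * a i) = 0"
    using insert.IH[of I] insert.hyps insert.prems by (metis card_insert_disjoint Suc_lessD)
  then obtain k where k: "k \<in> I" "u k \<noteq> 0" by auto
  have "card S < card (I - {k})" using insert.hyps insert.prems k by simp
  from insert.IH[OF finite_Diff[OF insert.prems(1)] this]
  obtain v where v: "\<exists>i\<in>I - {k}. v i \<noteq> 0" "\<forall>i. i \<notin> I - {k} \<longrightarrow> v i = 0"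
      "\<forall>a\<in>S. (\<Sum>i\<in>I - {k}. v i * a i) = 0"
    by (elim exE conjE)
  have v3: "(\<Sum>i\<in>I. v i * a i) = (\<Sum>i\<in>I - {k}. v i * a i)" for a
    using v(2) k insert.prems by (simp add: sum.remove)
  define U V where "U = (\<Sum>i\<in>I. u i * f i)" and "V = (\<Sum>i\<in>I. v i * f i)"
  show ?case
  proof (cases "V = 0")
    case True
    then show ?thesis using v v3 by (intro exI[of _ v]) (auto simp: V_def)
  next
    case False
    \<comment> \<open>Fraction-free elimination: \<open>u\<close> and \<open>v\<close> solve the
      equations in \<open>S\<close>, and this combination also solves \<open>f\<close>. As
      \<open>v k = 0\<close> while \<open>u k\<close> and \<open>V\<close> are nonzero, it does not
      vanish at \<open>k\<close>.\<close>
    let ?w = "\<lambda>i. U * v i - V * u i"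
    have int_comb: "(\<Sum>i\<in>I. ?w i * a i) = U * (\<Sum>i\<in>I. v i * a i) - V * (\<Sum>i\<in>I. u i * a i)" for a
      by (simp add: left_diff_distrib sum_subtractf sum_distrib_left mult.assoc)
    have "?w k \<noteq> 0" using False v k by simp
    moreover have "\<forall>a\<in>insert f S. (\<Sum>i\<in>I. ?w i * a i) = 0"
      unfolding int_comb using u v v3 by (auto simp: U_def V_def)
    moreover have "\<forall>i. i \<notin> I \<longrightarrow> ?w i = 0" using u(2) v(2) by simp
    ultimately show ?thesis by (intro exI[of _ ?w] conjI bexI[OF _ k(1)])
  qed
qed

text \<open>Halving the entries as long as all are even terminates because
  \<open>\<bar>u k\<bar>\<close> shrinks. In this way an annihilator can be made nonzero modulo
  2.\<close>

lemma extract_power_of_two: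
  fixes u :: "nat \<Rightarrow> int"
  assumes "k < m" "u k \<noteq> 0"
  shows "\<exists>v c. c \<noteq> 0 \<and> (\<forall>i<m. u i = c * v i) \<and> (\<exists>i<m. odd (v i))"
  using assms(2)
proof (induction "nat \<bar>u k\<bar>" arbitrary: u rule: less_induct)
  case less
  show ?case
  proof (cases "\<exists>i<m. odd (u i)")
    case True
    then show ?thesis by (intro exI[of _ u] exI[of _ 1]) auto
  next
    case False
    let ?w = "\<lambda>i. u i div 2"
    have w: "u i = 2 * ?w i" if "i < m" for i using False that by auto
    have "nat \<bar>?w k\<bar> < nat \<bar>u k\<bar>" "?w k \<noteq> 0" using w[OF assms(1)] less.prems by linarith+
    from less.hyps[of ?w, OF this] obtain v c where
      vc: "c \<noteq> 0" "\<forall>i<m. ?w i = c * v i" "\<exists>i<m. odd (v i)" by auto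
    then have "u i = 2 * c * v i" if "i < m" for i using w[OF that] that by auto
    then show ?thesis using vc by (intro exI[of _ v] exI[of _ "2 * c"]) auto
  qed
qed

text \<open>A reduced echelon form with pivot columns \<open>P\<close>, scaled by a common
  denominator \<open>D\<close>. Oddness of \<open>D\<close> keeps the rows independent modulo 2 as
  well as over the rationals.\<close>

definition pivots :: "nat \<Rightarrow> (nat \<Rightarrow> int) set \<Rightarrow> nat set \<Rightarrow> int \<Rightarrow> (nat \<Rightarrow> nat \<Rightarrow> int) \<Rightarrow> bool" where
  "pivots m M P D b \<longleftrightarrow> P \<subseteq> {..<m} \<and> odd D \<and> b ` P \<subseteq> M \<and>
     (\<forall>p\<in>P. \<forall>r\<in>P. b p r = (if p = r then D else 0))"

text \<open>A largest pivot set works: a vector of \<open>ann m S\<close> that is not recovered from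
  its entries on \<open>P\<close> leaves a remainder vanishing on \<open>P\<close>. Divided by a
  suitable constant, the remainder has an odd entry, which would serve as a further pivot.\<close>

lemma pivots_exist:
  "\<exists>P D b. pivots m (ann m S) P D b \<and> (\<forall>u\<in>ann m S. \<forall>i<m. D * u i = (\<Sum>p\<in>P. u p * b p i))"
proof -
  let ?Q = "\<lambda>P. \<exists>D b. pivots m (ann m S) P D b"
  have 0: "?Q {}" by (auto simp: pivots_def intro!: exI[of _ 1])
  have "\<forall>P. ?Q P \<longrightarrow> card P \<le> m"
    using card_mono[of "{..<m}"] by (auto simp: pivots_def)
  then obtain P where P: "?Q P" "\<And>P'. ?Q P' \<Longrightarrow> card P' \<le> card P"
    using ex_has_greatest_nat[of ?Q "{}" card "Suc m"] 0 by (auto simp: less_Suc_eq_le)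
  then obtain D b where pv: "pivots m (ann m S) P D b" by blast
  have fin: "finite P" using pv finite_subset by (auto simp: pivots_def)
  have "D * u i = (\<Sum>p\<in>P. u p * b p i)" if u: "u \<in> ann m S" and i: "i < m" for u i
  proof (rule ccontr)
    assume neq: "D * u i \<noteq> (\<Sum>p\<in>P. u p * b p i)"
    define w where "w = (\<lambda>i. D * u i - (\<Sum>p\<in>P. u p * b p i))"
    have b_ann: "b p \<in> ann m S" if "p \<in> P" for p using pv that by (auto simp: pivots_def)
    have w_ann: "ip m w a = 0" if "a \<in> S" for a
      using u b_ann that unfolding w_def by (simp add: ip_diff ip_scale ip_sum ann_def)
    have wP: "w r = 0" if "r \<in> P" for r
    proof -
      have "(\<Sum>p\<in>P. u p * b p r) = (\<Sum>p\<in>P. if p = r then u p * D else 0)"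
        using pv that by (intro sum.cong) (auto simp: pivots_def)
      also have "\<dots> = u r * D" using fin that by simp
      finally show ?thesis by (simp add: w_def)
    qed
    obtain v c where vc: "c \<noteq> 0" "\<forall>i<m. w i = c * v i" "\<exists>i<m. odd (v i)"
      using extract_power_of_two[of i m w] neq i by (auto simp: w_def)
    then obtain t where t: "t < m" "odd (v t)" by auto
    have v_ann: "ip m v a = 0" if "a \<in> S" for a
    proof -
      have "c * ip m v a = ip m w a" unfolding ip_scale[symmetric] using vc(2) by (intro ip_cong) auto
      then show ?thesis using vc(1) w_ann[OF that] by simp
    qed
    have P_less: "P \<subseteq> {..<m}" using pv by (simp add: pivots_def)
    have vP: "v r = 0" if "r \<in> P" for r
      using wP[OF that] vc(1,2) that P_less by auto
    have tP: "t \<notin> P" using vP t by auto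
    \<comment> \<open>\<open>D * v\<close> is the row of the new pivot \<open>t\<close>, as
      \<open>v\<close> vanishes on \<open>P\<close>. The old rows are multiplied by
      \<open>v t\<close> and cleared at \<open>t\<close>; the new denominator \<open>D * v t\<close>
      is again odd.\<close>
    define b' where "b' = (\<lambda>p. if p = t then (\<lambda>i. D * v i) else (\<lambda>i. v t * b p i - b p t * v i))"
    have "pivots m (ann m S) (insert t P) (D * v t) b'"
      unfolding pivots_def
    proof (intro conjI)
      show "b' ` insert t P \<subseteq> ann m S"
        using v_ann b_ann by (auto simp: b'_def ann_def ip_diff ip_scale)
      show "\<forall>p\<in>insert t P. \<forall>r\<in>insert t P. b' p r = (if p = r then D * v t else 0)"
        using pv vP tP by (auto simp: b'_def pivots_def)
    qed (use pv t in \<open>auto simp: pivots_def\<close>)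
    then have "card (insert t P) \<le> card P" using P(2) by blast
    then show False using tP fin by simp
  qed
  then show ?thesis using pv by blast
qed

text \<open>With fewer than \<open>m - card S\<close> pivots, the coordinates outside
  \<open>P\<close> would outnumber \<open>S\<close> and carry a nonzero annihilator, whereas an
  annihilator vanishing on \<open>P\<close> is zero. Since the rows of \<open>b\<close> generate all
  annihilators up to the factor \<open>D\<close>, their kernel is the closure.\<close>

lemma annihilator_pivots:
  assumes "finite S"
  obtains P D b where "pivots m (ann m S) P D b" "m \<le> card P + card S"
    "cl m S = {x. \<forall>p\<in>P. ip m (b p) x = 0}"
proof -
  obtain P D b where P: "pivots m (ann m S) P D b"
    "\<And>u i. u \<in> ann m S \<Longrightarrow> i < m \<Longrightarrow> D * u i = (\<Sum>p\<in>P. u p * b p i)"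
    using pivots_exist[of m S] by blast
  have D: "D \<noteq> 0" and sub: "P \<subseteq> {..<m}" and b: "\<And>p. p \<in> P \<Longrightarrow> b p \<in> ann m S"
    using P(1) by (auto simp: pivots_def)
  have "m \<le> card P + card S"
  proof (rule ccontr)
    assume "\<not> m \<le> card P + card S"
    then have "card S < card ({..<m} - P)" using sub by (simp add: card_Diff_subset finite_subset)
    then obtain u where u: "\<exists>i\<in>{..<m} - P. u i \<noteq> 0" "\<forall>i. i \<notin> {..<m} - P \<longrightarrow> u i = 0"
      "\<forall>a\<in>S. (\<Sum>i\<in>{..<m} - P. u i * a i) = 0"
      using homogeneous_system[of S "{..<m} - P"] assms by auto
    have "ip m u a = (\<Sum>i\<in>{..<m} - P. u i * a i)" for a
      unfolding ip_def using u(2) by (intro sum.mono_neutral_right) auto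
    then have "u \<in> ann m S" using u by (simp add: ann_def)
    moreover have "(\<Sum>p\<in>P. u p * b p i) = 0" for i using u by (intro sum.neutral) auto
    ultimately show False using P(2)[of u] u(1) D by force
  qed
  moreover have "cl m S = {x. \<forall>p\<in>P. ip m (b p) x = 0}"
  proof safe
    fix x p assume "x \<in> cl m S" "p \<in> P"
    then show "ip m (b p) x = 0" using b by (auto simp: cl_def)
  next
    fix x assume x: "\<forall>p\<in>P. ip m (b p) x = 0"
    show "x \<in> cl m S" unfolding cl_def
    proof safe
      fix u assume u: "u \<in> ann m S"
      have "D * ip m u x = ip m (\<lambda>i. \<Sum>p\<in>P. u p * b p i) x"
        unfolding ip_scale[symmetric] using P(2)[OF u] by (intro ip_cong) auto
      also have "\<dots> = 0" using x by (simp add: ip_sum)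
      finally show "ip m u x = 0" using D by simp
    qed
  qed
  ultimately show ?thesis using that P(1) by blast
qed

text \<open>The row of a pivot \<open>p\<close> expresses \<open>D * x p\<close> through the
  coordinates outside \<open>P\<close>, so these determine a vector of the kernel. This is the input
  for \<open>prob_determined_le\<close>.\<close>

lemma cl_determined:
  assumes "finite S"
  shows "\<exists>T\<subseteq>{..<m}. card T \<le> card S \<and>
    (\<forall>x\<in>cl m S. \<forall>y\<in>cl m S. (\<forall>i\<in>T. x i = y i) \<longrightarrow> (\<forall>i<m. x i = y i))"
proof -
  obtain P D b where P: "pivots m (ann m S) P D b" "m \<le> card P + card S"
    "cl m S = {x. \<forall>p\<in>P. ip m (b p) x = 0}"
    using annihilator_pivots[OF assms] by blast
  have sub: "P \<subseteq> {..<m}" and D: "D \<noteq> 0" using P(1) by (auto simp: pivots_def)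
  have "x i = y i" if x: "x \<in> cl m S" and y: "y \<in> cl m S"
    and e: "\<And>i. i \<in> {..<m} - P \<Longrightarrow> x i = y i" and i: "i < m" for x y i
  proof (cases "i \<in> P")
    case True
    have "0 = ip m (b i) x - ip m (b i) y" using x y True P(3) by simp
    also have "\<dots> = (\<Sum>j<m. b i j * (x j - y j))"
      by (simp add: ip_def algebra_simps sum_subtractf)
    also have "\<dots> = (\<Sum>j<m. if j = i then D * (x i - y i) else 0)"
    proof (rule sum.cong)
      fix j assume "j \<in> {..<m}"
      then show "b i j * (x j - y j) = (if j = i then D * (x i - y i) else 0)"
        using P(1) True e by (cases "j \<in> P") (auto simp: pivots_def)
    qed simp
    also have "\<dots> = D * (x i - y i)" using i by simp
    finally show ?thesis using D by simp
  qed (use e i in auto)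
  moreover have "card ({..<m} - P) \<le> card S" using P(2) sub by (simp add: card_Diff_subset finite_subset)
  ultimately show ?thesis by (intro exI[of _ "{..<m} - P"]) auto
qed

section \<open>Echelon forms modulo 2\<close>

lemma parity_pivots:
  fixes K :: "(nat \<Rightarrow> int) set"
  assumes K: "\<And>w i. w \<in> K \<Longrightarrow> w i \<in> {0, 1}" "\<And>w i. w \<in> K \<Longrightarrow> i \<ge> m \<Longrightarrow> w i = 0"
    and "2 ^ l < card K"
  shows "\<exists>f\<in>{..<l} \<rightarrow>\<^sub>E K. \<exists>P b. P \<subseteq> {..<m} \<and> card P = l \<and>
     (\<forall>p\<in>P. \<forall>r\<in>P. odd (b p r) \<longleftrightarrow> p = r) \<and>
     (\<forall>x. (\<forall>j<l. even (ip m (f j) x)) \<longrightarrow> (\<forall>p\<in>P. even (ip m (b p) x)))"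
  using assms(3)
proof (induction l)
  case 0
  show ?case by (intro bexI[of _ "\<lambda>_. undefined"] exI[of _ "{}"]) auto
next
  case (Suc l)
  then have "2 ^ l < card K" by simp
  from Suc.IH[OF this] obtain f P b where f: "f \<in> {..<l} \<rightarrow>\<^sub>E K" and P: "P \<subseteq> {..<m}" "card P = l"
    and b: "\<And>p r. p \<in> P \<Longrightarrow> r \<in> P \<Longrightarrow> odd (b p r) \<longleftrightarrow> p = r"
    and fb: "\<And>x p. (\<forall>j<l. even (ip m (f j) x)) \<Longrightarrow> p \<in> P \<Longrightarrow> even (ip m (b p) x)" by metis
  have finP: "finite P" using P finite_subset by auto
  \<comment> \<open>Some vector of \<open>K\<close> is not a combination modulo 2 of the rows found
    so far. Otherwise every vector of \<open>K\<close> would be determined by its entries on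
    \<open>P\<close>, leaving at most \<open>2 ^ l\<close> of them.\<close>
  have "\<exists>w t. w \<in> K \<and> t < m \<and> odd (w t - (\<Sum>p\<in>P. w p * b p t))"
  proof (rule ccontr)
    assume "\<not> ?thesis"
    then have ev: "even (w t - (\<Sum>p\<in>P. w p * b p t))" if "w \<in> K" "t < m" for w t using that by blast
    have "inj_on (\<lambda>w. {p\<in>P. w p = 1}) K"
    proof (rule inj_onI)
      fix w v assume wv: "w \<in> K" "v \<in> K" "{p \<in> P. w p = 1} = {p \<in> P. v p = 1}"
      have "w p = v p" if "p \<in> P" for p using set_eq_iff[THEN iffD1, OF wv(3), rule_format, of p] that K(1)[OF wv(1), of p] K(1)[OF wv(2), of p]
        by auto
      then have s: "(\<Sum>p\<in>P. w p * b p i) = (\<Sum>p\<in>P. v p * b p i)" for i by simp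
      have "w i = v i" for i
      proof (cases "i < m")
        case True
        then have "even (w i - v i)" using ev[OF wv(1) True] ev[OF wv(2) True] s[of i] by fastforce
        then show ?thesis using K(1)[OF wv(1), of i] K(1)[OF wv(2), of i] by auto
      next
        case False
        then show ?thesis using K(2)[of w i] K(2)[of v i] wv(1,2) by simp
      qed
      then show "w = v" by auto
    qed
    then have "card K \<le> card (Pow P)" using finP by (intro card_inj_on_le) auto
    then show False using Suc.prems P(2) finP by (simp add: card_Pow)
  qed
  then obtain w t where wt: "w \<in> K" "t < m" "odd (w t - (\<Sum>p\<in>P. w p * b p t))" by blast
  define v where "v = (\<lambda>i. w i - (\<Sum>p\<in>P. w p * b p i))"
  have vP: "even (v r)" if "r \<in> P" for r
  proof -
    have "(\<Sum>p\<in>P. w p * b p r) = w r * b r r + (\<Sum>p\<in>P - {r}. w p * b p r)"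
      using finP that by (simp add: sum.remove)
    moreover have "even (\<Sum>p\<in>P - {r}. w p * b p r)"
      using b that by (intro dvd_sum) auto
    ultimately show ?thesis unfolding v_def using b[OF that that] by simp
  qed
  have vt: "odd (v t)" using wt by (simp add: v_def)
  have tP: "t \<notin> P" using vP vt by auto
  define g where "g = (\<lambda>j. if j = l then w else f j)"
  have g: "g \<in> {..<Suc l} \<rightarrow>\<^sub>E K" using f wt(1) by (auto simp: g_def PiE_iff extensional_def)
  have gf: "even (ip m (f j) x)" if "\<forall>j<Suc l. even (ip m (g j) x)" "j < l" for j x
    using that(1)[rule_format, of j] that(2) by (simp add: g_def)
  have gv: "even (ip m v x)" if x: "\<forall>j<Suc l. even (ip m (g j) x)" for x
  proof -
    have "ip m v x = ip m w x - (\<Sum>p\<in>P. w p * ip m (b p) x)"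
      unfolding v_def by (simp add: ip_diff ip_sum)
    moreover have "even (\<Sum>p\<in>P. w p * ip m (b p) x)" using gf[OF x] fb by (intro dvd_sum) auto
    moreover have "even (ip m w x)" using x[rule_format, of l] by (simp add: g_def)
    ultimately show ?thesis by simp
  qed
  define b' where "b' = (\<lambda>p. if p = t then v else (\<lambda>i. b p i - b p t * v i))"
  have "even (ip m (b' p) x)" if x: "\<forall>j<Suc l. even (ip m (g j) x)" and p: "p \<in> insert t P" for x p
    using gv[OF x] fb[of x p] gf[OF x] p by (auto simp: b'_def ip_diff ip_scale)
  moreover have "\<forall>p\<in>insert t P. \<forall>r\<in>insert t P. odd (b' p r) \<longleftrightarrow> p = r"
    using b vP vt tP by (auto simp: b'_def)
  ultimately show ?case using g P wt(2) tP finP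
    by (intro bexI[of _ g] exI[of _ "insert t P"] exI[of _ b']) auto
qed

section \<open>Independent columns and the replacement argument\<close>

abbreviation "prob p \<equiv> measure_pmf.prob p"

section \<open>Conditioning in product measures\<close>

lemma prob_pair_le:
  assumes "0 \<le> c" "\<And>y. y \<in> set_pmf q \<Longrightarrow> prob p {x. A x y} \<le> c * prob p {x. B x y}"
  shows "prob (pair_pmf p q) {(x, y). A x y} \<le> c * prob (pair_pmf p q) {(x, y). B x y}"
proof -
  have e: "emeasure (pair_pmf p q) {(x, y). A x y} = (\<integral>\<^sup>+ y. emeasure p {x. A x y} \<partial>q)" for A
  proof -
    have "emeasure (pair_pmf p q) {(x, y). A x y}
        = (\<integral>\<^sup>+ z. indicator {(x, y). A x y} z \<partial>map_pmf (\<lambda>(x, y). (y, x)) (pair_pmf q p))"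
      by (simp flip: pair_commute_pmf)
    also have "\<dots> = (\<integral>\<^sup>+ y. \<integral>\<^sup>+ x. indicator {(x, y). A x y} (x, y) \<partial>p \<partial>q)"
      by (simp add: nn_integral_pair_pmf')
    also have "\<dots> = (\<integral>\<^sup>+ y. \<integral>\<^sup>+ x. indicator {x. A x y} x \<partial>p \<partial>q)"
      by (simp add: indicator_def)
    finally show ?thesis by simp
  qed
  have "emeasure (pair_pmf p q) {(x, y). A x y} \<le> (\<integral>\<^sup>+ y. ennreal c * emeasure p {x. B x y} \<partial>q)"
    unfolding e using assms
    by (intro nn_integral_mono_AE AE_pmfI)
       (simp add: measure_pmf.emeasure_eq_measure ennreal_mult[symmetric] ennreal_leI)
  also have "\<dots> = ennreal c * emeasure (pair_pmf p q) {(x, y). B x y}"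
    unfolding e by (simp add: nn_integral_cmult)
  finally show ?thesis
    using assms(1) by (simp add: measure_pmf.emeasure_eq_measure ennreal_mult[symmetric])
qed

lemma prob_pair_Times: "prob (pair_pmf p q) {(x, y). A x \<and> B y} = prob p {x. A x} * prob q {y. B y}"
proof -
  have "emeasure (pair_pmf p q) {(x, y). A x \<and> B y}
      = (\<integral>\<^sup>+ x. \<integral>\<^sup>+ y. indicator {x. A x} x * indicator {y. B y} y \<partial>q \<partial>p)"
    by (simp flip: nn_integral_indicator add: nn_integral_pair_pmf') (simp add: indicator_def of_bool_conj)
  also have "\<dots> = emeasure p {x. A x} * emeasure q {y. B y}"
    by (simp add: nn_integral_cmult nn_integral_multc)
  finally show ?thesis
    by (simp add: measure_pmf.emeasure_eq_measure ennreal_mult[symmetric])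
qed

text \<open>Conditioning on the coordinates in \<open>T\<close>: the necessary condition
  \<open>F\<close> depends on them only, and once they are fixed, \<open>E\<close> has probability
  at most \<open>c\<close> over the remaining coordinates.\<close>

lemma Pi_pmf_factor_le:
  fixes p :: "'a \<Rightarrow> 'b pmf"
  assumes "finite A" "T \<subseteq> A" "0 \<le> c"
    and EF: "\<And>h. h \<in> E \<Longrightarrow> F h"
    and F_local: "\<And>h h'. (\<And>x. x \<in> T \<Longrightarrow> h x = h' x) \<Longrightarrow> F h = F h'"
    and bound: "\<And>h. F h \<Longrightarrow> prob (Pi_pmf (A - T) d p) {g. (\<lambda>x. if x \<in> T then h x else g x) \<in> E} \<le> c"
  shows "prob (Pi_pmf A d p) E \<le> prob (Pi_pmf A d p) {h. F h} * c"
proof -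
  let ?mg = "\<lambda>f g x. if x \<in> T then f x else g x"
  let ?R = "pair_pmf (Pi_pmf (A - T) d p) (Pi_pmf T d p)"
  have "Pi_pmf A d p = map_pmf (\<lambda>(f, g) x. if x \<in> T then f x else g x)
      (pair_pmf (Pi_pmf T d p) (Pi_pmf (A - T) d p))"
    using Pi_pmf_union[of T "A - T" d p] assms(1,2) by (simp add: finite_subset Un_absorb1)
  also have "\<dots> = map_pmf (\<lambda>(g, f) x. if x \<in> T then f x else g x) ?R"
    by (subst pair_commute_pmf) (simp add: map_pmf_comp case_prod_unfold cong: if_cong)
  finally have split: "Pi_pmf A d p = map_pmf (\<lambda>(g, f) x. if x \<in> T then f x else g x) ?R" .
  have "prob (Pi_pmf A d p) E = prob ?R {(g, f). ?mg f g \<in> E}"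
    unfolding split by (simp add: vimage_def case_prod_unfold)
  also have "\<dots> \<le> c * prob ?R {(g, f). F f}"
  proof (rule prob_pair_le)
    fix f
    show "prob (Pi_pmf (A - T) d p) {g. ?mg f g \<in> E} \<le> c * prob (Pi_pmf (A - T) d p) {g. F f}"
    proof (cases "F f")
      case True
      then show ?thesis using bound[of f] by simp
    next
      case False
      then have "?mg f g \<notin> E" for g using EF[of "?mg f g"] F_local[of f "?mg f g"] by auto
      then show ?thesis using assms(3) by simp
    qed
  qed fact
  also have "prob ?R {(g, f). F f} = prob ?R {(g, f). F (?mg f g)}"
  proof -
    have "F f = F (?mg f g)" for f g by (rule F_local) simp
    then show ?thesis by simp
  qed
  also have "\<dots> = prob (Pi_pmf A d p) {h. F h}"
    unfolding split by (simp add: vimage_def case_prod_unfold)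
  finally show ?thesis by (simp add: mult.commute)
qed

lemma prob_Pi_pmf_all:
  assumes "finite A"
  shows "prob (Pi_pmf A d (\<lambda>_. p)) {f. f ` A \<subseteq> V} = prob p V ^ card A"
proof -
  have "{f. f ` A \<subseteq> V} = Pi A (\<lambda>_. V)" by auto
  then show ?thesis using assms by (simp add: measure_Pi_pmf_Pi)
qed

lemma prob_Pi_pmf_singleton: "prob (Pi_pmf {a} d p) {g. Q (g a)} = prob (p a) {y. Q y}"
proof -
  have "{g. Q (g a)} = Pi {a} (\<lambda>_. {y. Q y})" by auto
  then show ?thesis by (simp add: measure_Pi_pmf_Pi)
qed

text \<open>Odlyzko's argument.\<close>

lemma prob_determined_le:
  assumes "finite A" "T \<subseteq> A" "\<And>x v. x \<in> A \<Longrightarrow> pmf (p x) v \<le> r"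
    and det: "\<And>x y. x \<in> E \<Longrightarrow> y \<in> E \<Longrightarrow> (\<And>i. i \<in> T \<Longrightarrow> x i = y i) \<Longrightarrow> (\<And>i. i \<in> A \<Longrightarrow> x i = y i)"
  shows "prob (Pi_pmf A d p) E \<le> r ^ (card A - card T)"
proof (cases "A = {}")
  case False
  then obtain a v where "a \<in> A" by auto
  then have r: "0 \<le> r" using assms(3)[of a undefined] pmf_nonneg[of "p a" undefined] by linarith
  let ?B = "A - T"
  let ?mg = "\<lambda>f g x. if x \<in> T then f x else g x"
  have "prob (Pi_pmf A d p) E \<le> prob (Pi_pmf A d p) {h. True} * r ^ card ?B"
  proof (rule Pi_pmf_factor_le[where T = T])
    fix h
    \<comment> \<open>The product law takes the value \<open>d\<close> off \<open>?B\<close> almost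
      surely. With this constraint the set has at most one element, because \<open>E\<close>
      determines the coordinates in \<open>?B\<close> and \<open>d\<close> gives all others.\<close>
    let ?G = "{g. ?mg h g \<in> E} \<inter> {g. \<forall>x. x \<notin> ?B \<longrightarrow> g x = d}"
    have out: "prob (Pi_pmf ?B d p) {g. ?mg h g \<in> E} \<le> prob (Pi_pmf ?B d p) ?G"
    proof -
      have "prob (Pi_pmf ?B d p) {g. ?mg h g \<in> E} = prob (Pi_pmf ?B d p) ({g. ?mg h g \<in> E} \<inter> set_pmf (Pi_pmf ?B d p))"
        by (simp add: measure_Int_set_pmf)
      also have "\<dots> \<le> prob (Pi_pmf ?B d p) ?G"
        using set_Pi_pmf_subset[of ?B d p] assms(1) by (intro measure_pmf.finite_measure_mono) auto
      finally show ?thesis .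
    qed
    show "prob (Pi_pmf ?B d p) {g. ?mg h g \<in> E} \<le> r ^ card ?B"
    proof (cases "?G = {}")
      case True
      then show ?thesis using out r by (smt (verit) measure_empty zero_le_power)
    next
      case False
      then obtain g where g: "g \<in> ?G" by blast
      have "?G \<subseteq> {g}"
      proof safe
        fix g' assume g': "?mg h g' \<in> E" "\<forall>x. x \<notin> ?B \<longrightarrow> g' x = d"
        have "g' x = g x" for x
        proof (cases "x \<in> ?B")
          case True
          then show ?thesis using det[of "?mg h g'" "?mg h g" x] g g' by auto
        next
          case False
          then show ?thesis using g g' by auto
        qed
        then show "g' = g" by auto
      qed
      then have "prob (Pi_pmf ?B d p) ?G \<le> pmf (Pi_pmf ?B d p) g"
        by (simp add: pmf.rep_eq measure_pmf.finite_measure_mono)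
      also have "\<dots> = (\<Prod>x\<in>?B. pmf (p x) (g x))" using g assms(1) by (subst pmf_Pi') auto
      also have "\<dots> \<le> (\<Prod>x\<in>?B. r)" using assms(3) by (intro prod_mono) auto
      finally show ?thesis using out by simp
    qed
  qed (use assms r in auto)
  then show ?thesis using assms(1,2) by (simp add: card_Diff_subset finite_subset)
qed auto

text \<open>Union bound over an index \<open>j\<close> whose vector depends on the others. Given the
  others, which lie in \<open>V\<close>, the vector \<open>Y j\<close> must fall into the span of at
  most \<open>s - 1\<close> vectors, which has probability at most \<open>h\<close>.\<close>

lemma prob_dependent_le:
  assumes rare: "\<And>Z. finite Z \<Longrightarrow> card Z < s \<Longrightarrow> prob q (cl m Z) \<le> h" and "0 \<le> h"
  shows "prob (Pi_pmf {..<s} d (\<lambda>_. q)) {Y. Y ` {..<s} \<subseteq> V \<and> \<not> indep_family m s Y} \<le> s * (prob q V ^ (s - 1) * h)"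
proof -
  let ?Q = "Pi_pmf {..<s} d (\<lambda>_. q)"
  let ?E = "\<lambda>j. {Y. Y ` {..<s} \<subseteq> V \<and> Y j \<in> cl m (Y ` ({..<s} - {j}))}"
  have "prob ?Q {Y. Y ` {..<s} \<subseteq> V \<and> \<not> indep_family m s Y} \<le> prob ?Q (\<Union>j\<in>{..<s}. ?E j)"
    by (intro measure_pmf.finite_measure_mono) (auto simp: indep_family_def)
  also have "\<dots> \<le> (\<Sum>j<s. prob ?Q (?E j))"
    by (intro measure_pmf.finite_measure_subadditive_finite) auto
  also have "\<dots> \<le> (\<Sum>j<s. prob q V ^ (s - 1) * h)"
  proof (rule sum_mono)
    fix j assume "j \<in> {..<s}"
    then have j: "j < s" by simp
    let ?T = "{..<s} - {j}"
    have c: "card ?T = s - 1" using j by simp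
    have "prob ?Q (?E j) \<le> prob ?Q {Y. Y ` ?T \<subseteq> V} * h"
    proof (rule Pi_pmf_factor_le[where T = ?T])
      fix f assume "f ` ?T \<subseteq> V"
      have im: "(\<lambda>x. if x \<in> ?T then f x else g x) ` ?T = f ` ?T" for g by (rule image_cong) auto
      have "{..<s} - ?T = {j}" using j by auto
      moreover have "prob (Pi_pmf {j} d (\<lambda>_. q)) {g. (\<lambda>x. if x \<in> ?T then f x else g x) \<in> ?E j}
          \<le> prob (Pi_pmf {j} d (\<lambda>_. q)) {g. g j \<in> cl m (f ` ?T)}"
        by (intro measure_pmf.finite_measure_mono) (auto simp: im)
      moreover have "\<dots> = prob q (cl m (f ` ?T))" using prob_Pi_pmf_singleton[of j d "\<lambda>_. q" "\<lambda>y. y \<in> cl m (f ` ?T)"] by simp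
      moreover have "\<dots> \<le> h"
      proof (rule rare)
        have "card (f ` ?T) \<le> card ?T" by (intro card_image_le) auto
        then show "card (f ` ?T) < s" using c j by linarith
      qed auto
      ultimately show "prob (Pi_pmf ({..<s} - ?T) d (\<lambda>_. q)) {g. (\<lambda>x. if x \<in> ?T then f x else g x) \<in> ?E j} \<le> h"
        by simp
    next
      fix f f' :: "nat \<Rightarrow> nat \<Rightarrow> int" assume "\<And>x. x \<in> ?T \<Longrightarrow> f x = f' x"
      then have "f ` ?T = f' ` ?T" by (intro image_cong) auto
      then show "(f ` ?T \<subseteq> V) = (f' ` ?T \<subseteq> V)" by simp
    qed (use assms in auto)
    also have "prob ?Q {Y. Y ` ?T \<subseteq> V} = prob q V ^ (s - 1)"
    proof -
      have "{Y. Y ` ?T \<subseteq> V} = Pi {..<s} (\<lambda>i. {y. i \<in> ?T \<longrightarrow> y \<in> V})" 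
        by (auto simp: Pi_iff image_subset_iff)
      then have "prob ?Q {Y. Y ` ?T \<subseteq> V} = (\<Prod>i<s. prob q {y. i \<in> ?T \<longrightarrow> y \<in> V})"
        by (simp add: measure_Pi_pmf_Pi)
      also have "\<dots> = (\<Prod>i\<in>?T. prob q V)"
        by (rule prod.mono_neutral_cong_right) auto
      finally show ?thesis using c by simp
    qed
    finally show "prob ?Q (?E j) \<le> prob q V ^ (s - 1) * h" .
  qed
  finally show ?thesis by simp
qed

text \<open>
  For a fixed \<open>V\<close>, consider the event that the columns of \<open>X\<close> span \<open>V\<close> and that \<open>s\<close>
  independent vectors with law \<open>q\<close> lie in \<open>V\<close>.  By Steinitz exchange these vectors and all but
  \<open>s\<close> columns of \<open>X\<close> already span \<open>V\<close>, an event that is disjoint for distinct \<open>V\<close>, while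
  the remaining \<open>s\<close> columns lie in \<open>V\<close>.
\<close>

lemma swap_bound:
  fixes p q :: "(nat \<Rightarrow> int) pmf" and S :: "nat set"
  assumes fin: "finite S" "finite (set_pmf p)"
    and rare: "\<And>Z. finite Z \<Longrightarrow> card Z < s \<Longrightarrow> prob q (cl m Z) \<le> h" "0 \<le> h"
    and R: "0 \<le> R"
  shows "prob (Pi_pmf S d (\<lambda>_. p)) {X. \<exists>V. cl m (X ` S) = V \<and> prob p V \<le> R * prob q V \<and> 2 * s * h \<le> prob q V \<and> 0 < prob q V}
     \<le> 2 * 2 ^ card S * R ^ s"
proof -
  let ?QX = "Pi_pmf S d (\<lambda>_. p)"
  let ?QY = "Pi_pmf {..<s} d (\<lambda>_. q)"
  let ?QQ = "pair_pmf ?QX ?QY"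
  define good where "good V \<longleftrightarrow> prob p V \<le> R * prob q V \<and> 2 * s * h \<le> prob q V \<and> 0 < prob q V" for V
  define \<J> where "\<J> = {J. J \<subseteq> S \<and> card J + s = card S}"
  have fJ: "finite \<J>" using fin by (simp add: \<J>_def)
  define g where "g V = prob ?QX {X. cl m (X ` S) = V}" for V
  define H where "H J V = prob ?QQ {(X, Y). cl m (Y ` {..<s} \<union> X ` J) = V}" for J V
  have main: "g V \<le> (\<Sum>J\<in>\<J>. H J V) * (2 * R ^ s)" if V: "good V" for V
  proof -
    \<comment> \<open>As \<open>2 * s * h \<le> prob q V\<close>, dependent families account for at
      most half of \<open>prob q V ^ s\<close>.\<close>
    have Ys: "prob q V ^ s \<le> 2 * prob ?QY {Y. Y ` {..<s} \<subseteq> V \<and> indep_family m s Y}"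
    proof -
      have "prob q V ^ s = prob ?QY {Y. Y ` {..<s} \<subseteq> V}" by (simp add: prob_Pi_pmf_all)
      also have "\<dots> \<le> prob ?QY ({Y. Y ` {..<s} \<subseteq> V \<and> indep_family m s Y} \<union> {Y. Y ` {..<s} \<subseteq> V \<and> \<not> indep_family m s Y})"
        by (intro measure_pmf.finite_measure_mono) auto
      also have "\<dots> \<le> prob ?QY {Y. Y ` {..<s} \<subseteq> V \<and> indep_family m s Y} + prob ?QY {Y. Y ` {..<s} \<subseteq> V \<and> \<not> indep_family m s Y}"
        by (intro measure_Un_le) auto
      also have "prob ?QY {Y. Y ` {..<s} \<subseteq> V \<and> \<not> indep_family m s Y} \<le> s * (prob q V ^ (s - 1) * h)"
        using rare by (rule prob_dependent_le)
      also have "s * (prob q V ^ (s - 1) * h) \<le> prob q V ^ s / 2"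
      proof (cases s)
        case (Suc t)
        have "2 * (s * (prob q V ^ (s - 1) * h)) = prob q V ^ t * (2 * s * h)" using Suc by simp
        also have "\<dots> \<le> prob q V ^ t * prob q V" using V by (intro mult_left_mono) (auto simp: good_def)
        finally show ?thesis using Suc by (simp add: mult.commute)
      qed simp
      finally show ?thesis by simp
    qed
    have "g V * prob q V ^ s \<le> 2 * (g V * prob ?QY {Y. Y ` {..<s} \<subseteq> V \<and> indep_family m s Y})"
      using mult_left_mono[OF Ys, of "g V"] by (simp add: g_def)
    also have "g V * prob ?QY {Y. Y ` {..<s} \<subseteq> V \<and> indep_family m s Y}
        = prob ?QQ {(X, Y). cl m (X ` S) = V \<and> Y ` {..<s} \<subseteq> V \<and> indep_family m s Y}"
      unfolding g_def by (rule prob_pair_Times[symmetric])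
    also have "\<dots> \<le> prob ?QQ (\<Union>J\<in>\<J>. {(X, Y). cl m (Y ` {..<s} \<union> X ` J) = V \<and> X ` (S - J) \<subseteq> V})"
    proof (intro measure_pmf.finite_measure_mono subsetI)
      fix z assume z: "z \<in> {(X, Y). cl m (X ` S) = V \<and> Y ` {..<s} \<subseteq> V \<and> indep_family m s Y}"
      then obtain X Y where XY: "z = (X, Y)" by (cases z)
      have *: "V = cl m (X ` S)" "Y ` {..<s} \<subseteq> cl m (X ` S)" "indep_family m s Y"
        using z by (auto simp: XY)
      from steinitz_exchange[OF fin(1) *(3,2)] obtain J where
        J: "J \<subseteq> S" "card J + s = card S" "X ` S \<subseteq> cl m (Y ` {..<s} \<union> X ` J)" by blast
      have "cl m (Y ` {..<s} \<union> X ` J) = cl m (X ` S)"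
        using J cl_superset[of "X ` S" m] *(2)
        by (intro subset_antisym cl_subset) auto
      then show "z \<in> (\<Union>J\<in>\<J>. {(X, Y). cl m (Y ` {..<s} \<union> X ` J) = V \<and> X ` (S - J) \<subseteq> V})"
        unfolding *(1) XY
        using J image_mono[of "S - J" S X] cl_superset[of "X ` S" m]
        by (intro UN_I[of J]) (auto simp: \<J>_def)
    qed simp
    also have "\<dots> \<le> (\<Sum>J\<in>\<J>. prob ?QQ {(X, Y). cl m (Y ` {..<s} \<union> X ` J) = V \<and> X ` (S - J) \<subseteq> V})"
      using fJ by (intro measure_pmf.finite_measure_subadditive_finite) auto
    also have "\<dots> \<le> (\<Sum>J\<in>\<J>. prob p V ^ s * H J V)"
    proof (rule sum_mono)
      fix J assume "J \<in> \<J>"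
      then have J: "J \<subseteq> S" "card (S - J) = s" using fin by (auto simp: \<J>_def card_Diff_subset finite_subset)
      show "prob ?QQ {(X, Y). cl m (Y ` {..<s} \<union> X ` J) = V \<and> X ` (S - J) \<subseteq> V} \<le> prob p V ^ s * H J V"
        unfolding H_def
      proof (rule prob_pair_le)
        fix Y :: "nat \<Rightarrow> nat \<Rightarrow> int"
        have im: "(\<lambda>x. if x \<in> J then f x else g x) ` J = f ` J"
             "(\<lambda>x. if x \<in> J then f x else g x) ` (S - J) = g ` (S - J)" for f g :: "nat \<Rightarrow> nat \<Rightarrow> int"
          by (auto intro: image_cong)
        \<comment> \<open>With \<open>Y\<close> fixed and the columns in \<open>J\<close> given, the
          \<open>s\<close> columns outside \<open>J\<close> are still independent, and each lies in
          \<open>V\<close> with probability \<open>prob p V\<close>.\<close>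
        have "prob ?QX {X. cl m (Y ` {..<s} \<union> X ` J) = V \<and> X ` (S - J) \<subseteq> V}
            \<le> prob ?QX {X. cl m (Y ` {..<s} \<union> X ` J) = V} * prob p V ^ s"
        proof (rule Pi_pmf_factor_le[where T = J])
          fix f :: "nat \<Rightarrow> nat \<Rightarrow> int"
          have "prob (Pi_pmf (S - J) d (\<lambda>_. p)) {g. (\<lambda>x. if x \<in> J then f x else g x) \<in>
               {X. cl m (Y ` {..<s} \<union> X ` J) = V \<and> X ` (S - J) \<subseteq> V}}
            \<le> prob (Pi_pmf (S - J) d (\<lambda>_. p)) {g. g ` (S - J) \<subseteq> V}"
            by (intro measure_pmf.finite_measure_mono) (simp_all add: im Collect_mono)
          then show "prob (Pi_pmf (S - J) d (\<lambda>_. p)) {g. (\<lambda>x. if x \<in> J then f x else g x) \<in>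
               {X. cl m (Y ` {..<s} \<union> X ` J) = V \<and> X ` (S - J) \<subseteq> V}} \<le> prob p V ^ s"
            using fin J by (simp add: prob_Pi_pmf_all)
        next
          fix f f' :: "nat \<Rightarrow> nat \<Rightarrow> int" assume "\<And>x. x \<in> J \<Longrightarrow> f x = f' x"
          then have "f ` J = f' ` J" by (intro image_cong) auto
          then show "(cl m (Y ` {..<s} \<union> f ` J) = V) = (cl m (Y ` {..<s} \<union> f' ` J) = V)" by simp
        qed (use fin J in auto)
        then show "prob ?QX {X. cl m (Y ` {..<s} \<union> X ` J) = V \<and> X ` (S - J) \<subseteq> V}
            \<le> prob p V ^ s * prob ?QX {X. cl m (Y ` {..<s} \<union> X ` J) = V}" by (simp add: mult.commute)
      qed simp
    qed
    also have "\<dots> = (\<Sum>J\<in>\<J>. H J V) * prob p V ^ s"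
      by (simp add: sum_distrib_right mult.commute)
    finally have 1: "g V * prob q V ^ s \<le> 2 * ((\<Sum>J\<in>\<J>. H J V) * prob p V ^ s)" by simp
    have "prob p V ^ s \<le> R ^ s * prob q V ^ s"
      using V unfolding good_def by (metis measure_nonneg power_mono power_mult_distrib)
    then have "2 * ((\<Sum>J\<in>\<J>. H J V) * prob p V ^ s) \<le> 2 * ((\<Sum>J\<in>\<J>. H J V) * (R ^ s * prob q V ^ s))"
      by (intro mult_left_mono sum_nonneg) (auto simp: H_def)
    with 1 have "g V * prob q V ^ s \<le> ((\<Sum>J\<in>\<J>. H J V) * (2 * R ^ s)) * prob q V ^ s"
      by (simp add: algebra_simps)
    moreover have "0 < prob q V ^ s" using V by (simp add: good_def)
    ultimately show ?thesis by (rule mult_right_le_imp_le)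
  qed
  \<comment> \<open>Only finitely many closures occur, as \<open>p\<close> has finite support. For
    each \<open>J\<close> their events are disjoint, so summing over \<open>V\<close> costs nothing;
    the choice of \<open>J\<close> costs \<open>2 ^ card S\<close>.\<close>
  define \<V> where "\<V> = (\<lambda>X. cl m (X ` S)) ` set_pmf ?QX"
  have finX: "finite (set_pmf ?QX)" using fin by (simp add: set_Pi_pmf finite_PiE_dflt)
  then have f\<V>: "finite \<V>" by (simp add: \<V>_def)
  have disj: "(\<Sum>V\<in>{V\<in>\<V>. good V}. H J V) \<le> 1" for J
  proof -
    have "(\<Sum>V\<in>{V\<in>\<V>. good V}. H J V) = prob ?QQ (\<Union>V\<in>{V\<in>\<V>. good V}. {(X, Y). cl m (Y ` {..<s} \<union> X ` J) = V})"
      unfolding H_def using f\<V>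
      by (intro measure_pmf.finite_measure_finite_Union[symmetric]) (auto simp: disjoint_family_on_def)
    then show ?thesis by simp
  qed
  have "prob ?QX {X. \<exists>V. cl m (X ` S) = V \<and> prob p V \<le> R * prob q V \<and> 2 * s * h \<le> prob q V \<and> 0 < prob q V}
      = prob ?QX ({X. good (cl m (X ` S))} \<inter> set_pmf ?QX)"
    by (simp add: measure_Int_set_pmf good_def)
  also have "\<dots> \<le> prob ?QX (\<Union>V\<in>{V\<in>\<V>. good V}. {X. cl m (X ` S) = V})"
    by (intro measure_pmf.finite_measure_mono) (auto simp: \<V>_def)
  also have "\<dots> \<le> (\<Sum>V\<in>{V\<in>\<V>. good V}. g V)"
    unfolding g_def using f\<V> by (intro measure_pmf.finite_measure_subadditive_finite) auto
  also have "\<dots> \<le> (\<Sum>V\<in>{V\<in>\<V>. good V}. (\<Sum>J\<in>\<J>. H J V) * (2 * R ^ s))"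
    using main by (intro sum_mono) auto
  also have "\<dots> = (\<Sum>J\<in>\<J>. \<Sum>V\<in>{V\<in>\<V>. good V}. H J V) * (2 * R ^ s)"
    unfolding sum_distrib_right[symmetric] by (subst sum.swap) (rule refl)
  also have "\<dots> \<le> (\<Sum>J\<in>\<J>. 1) * (2 * R ^ s)"
    using disj R by (intro mult_right_mono sum_mono) auto
  also have "(\<Sum>J\<in>\<J>. 1::real) \<le> 2 ^ card S"
  proof -
    have "card \<J> \<le> card (Pow S)" using fin by (intro card_mono) (auto simp: \<J>_def)
    then have "real (card \<J>) \<le> real (2 ^ card S)" using fin by (simp add: card_Pow del: of_nat_power)
    then show ?thesis by simp
  qed
  also have "2 ^ card S * (2 * R ^ s) = 2 * 2 ^ card S * R ^ s" by simp
  finally show ?thesis using R by (auto simp: mult_right_mono)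
qed

section \<open>Fourier inversion for kernels of integer matrices\<close>

definition bernoulli_int :: "real \<Rightarrow> int pmf" where
  "bernoulli_int q = map_pmf of_bool (bernoulli_pmf q)"

text \<open>For \<open>\<mu> \<le> 1/2\<close> the characteristic function of this symmetric law is
  real and nonnegative, so the Fourier sum for a kernel probability has no cancellation.\<close>

definition lazy_sign :: "real \<Rightarrow> int pmf" where
  "lazy_sign \<mu> = bind_pmf (bernoulli_pmf \<mu>)
     (\<lambda>b. map_pmf (\<lambda>c. of_bool b * (if c then 1 else -1)) (bernoulli_pmf (1/2)))"

text \<open>Frequencies count full turns, so the function has period 1. The sum is the full
  characteristic function for laws supported on \<open>{-1, 0, 1}\<close>, which covers both laws in
  use.\<close>

definition char_fun :: "int pmf \<Rightarrow> real \<Rightarrow> complex" where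
  "char_fun p t = (\<Sum>a\<in>{-1, 0, 1}. of_real (pmf p a) * cis (2 * pi * t * of_int a))"

lemma set_bernoulli_int: "set_pmf (bernoulli_int q) \<subseteq> {0, 1}"
  by (auto simp: bernoulli_int_def)

lemma set_lazy_sign: "set_pmf (lazy_sign \<mu>) \<subseteq> {-1, 0, 1}"
  by (auto simp: lazy_sign_def split: if_splits)

lemma pmf_bernoulli_int:
  assumes "0 \<le> q" "q \<le> 1"
  shows "pmf (bernoulli_int q) a = (if a = 1 then q else if a = 0 then 1 - q else 0)"
proof -
  have inj: "inj (of_bool :: bool \<Rightarrow> int)" by (auto simp: inj_def)
  have "pmf (bernoulli_int q) 1 = q" "pmf (bernoulli_int q) 0 = 1 - q"
    using pmf_map_inj'[OF inj, of "bernoulli_pmf q" True] pmf_map_inj'[OF inj, of "bernoulli_pmf q" False] assms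
    by (simp_all add: bernoulli_int_def)
  moreover have "a \<noteq> 1 \<Longrightarrow> a \<noteq> 0 \<Longrightarrow> pmf (bernoulli_int q) a = 0"
    using set_bernoulli_int[of q] by (auto simp: set_pmf_iff)
  ultimately show ?thesis by auto
qed

lemma pmf_lazy_sign:
  assumes "0 \<le> \<mu>" "\<mu> \<le> 1"
  shows "pmf (lazy_sign \<mu>) a = (if a = 0 then 1 - \<mu> else if a = 1 \<or> a = -1 then \<mu> / 2 else 0)"
proof -
  have *: "pmf (map_pmf (\<lambda>c. if c then 1 else -1 :: int) (bernoulli_pmf (1/2))) a
      = (if a = 1 \<or> a = -1 then 1/2 else 0)" for a
  proof -
    have inj: "inj (\<lambda>c. if c then 1 else -1 :: int)" by (auto simp: inj_def)
    show ?thesis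
      using pmf_map_inj'[OF inj, of "bernoulli_pmf (1/2)" True] pmf_map_inj'[OF inj, of "bernoulli_pmf (1/2)" False]
      by (cases "a = 1 \<or> a = -1") (auto simp: pmf_eq_0_set_pmf)
  qed
  show ?thesis
    unfolding lazy_sign_def pmf_bind using assms
    by (subst integral_bernoulli_pmf) (simp_all add: * map_pmf_const indicator_def)
qed

text \<open>The squared modulus equals 1 - 2 s with s = 2 q (1 - q) sin^2, which is at most (1 -
  s)^2. Roots may be taken because q (1 - q) \<le> 1/4 gives s \<le> 1/2.\<close>

lemma norm_char_fun_bernoulli_int:
  assumes "0 \<le> q" "q \<le> 1"
  shows "norm (char_fun (bernoulli_int q) t) \<le> 1 - 2 * q * (1 - q) * (sin (pi * t))\<^sup>2"
proof -
  have "char_fun (bernoulli_int q) t = of_real (1 - q) + of_real q * cis (2 * pi * t)"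
    using assms by (simp add: char_fun_def pmf_bernoulli_int)
  then have "(norm (char_fun (bernoulli_int q) t))\<^sup>2 = (1 - q + q * cos (2 * pi * t))\<^sup>2 + (q * sin (2 * pi * t))\<^sup>2"
    by (simp add: cmod_power2)
  also have "\<dots> = (1 - q)\<^sup>2 + q\<^sup>2 * ((sin (2 * pi * t))\<^sup>2 + (cos (2 * pi * t))\<^sup>2) + 2 * q * (1 - q) * cos (2 * pi * t)"
  proof -
    have "(1 - q + q * c)\<^sup>2 + (q * s)\<^sup>2 = (1 - q)\<^sup>2 + q\<^sup>2 * (s\<^sup>2 + c\<^sup>2) + 2 * q * (1 - q) * c" for c s
      by (simp add: power2_eq_square algebra_simps)
    then show ?thesis .
  qed
  also have "\<dots> = (1 - q)\<^sup>2 + q\<^sup>2 + 2 * q * (1 - q) * cos (2 * pi * t)"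
    by (simp only: sin_cos_squared_add mult_1_right)
  also have "cos (2 * pi * t) = 1 - 2 * (sin (pi * t))\<^sup>2"
    using cos_double_sin[of "pi * t"] by (simp add: mult.assoc)
  finally have e: "(norm (char_fun (bernoulli_int q) t))\<^sup>2 = 1 - 4 * q * (1 - q) * (sin (pi * t))\<^sup>2"
    by (simp add: power2_eq_square algebra_simps)
  let ?s = "2 * q * (1 - q) * (sin (pi * t))\<^sup>2"
  have "q * (1 - q) \<le> 1 / 4" using zero_le_power2[of "q - 1/2"] by (simp add: power2_eq_square algebra_simps)
  then have "2 * (q * (1 - q)) * (sin (pi * t))\<^sup>2 \<le> (1/2) * 1"
    using assms by (intro mult_mono) (auto simp: abs_square_le_1)
  then have "0 \<le> 1 - ?s" by (simp add: mult.assoc)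
  moreover have "(norm (char_fun (bernoulli_int q) t))\<^sup>2 \<le> (1 - ?s)\<^sup>2" unfolding e by (simp add: power2_diff)
  ultimately show ?thesis by (rule power2_le_imp_le[rotated])
qed

lemma char_fun_lazy_sign:
  assumes "0 \<le> \<mu>" "\<mu> \<le> 1"
  shows "char_fun (lazy_sign \<mu>) t = of_real (1 - 2 * \<mu> * (sin (pi * t))\<^sup>2)"
proof -
  have "char_fun (lazy_sign \<mu>) t = of_real (1 - \<mu> + \<mu> * cos (2 * pi * t))"
    using assms by (simp add: char_fun_def pmf_lazy_sign complex_eq_iff)
  also have "cos (2 * pi * t) = 1 - 2 * (sin (pi * t))\<^sup>2"
    using cos_double_sin[of "pi * t"] by (simp add: mult.assoc)
  finally show ?thesis by (simp add: algebra_simps)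
qed

text \<open>Orthogonality of characters modulo \<open>N\<close>. The size condition turns
  divisibility of \<open>z\<close> by \<open>N\<close> into \<open>z = 0\<close>.\<close>

lemma sum_cis_roots:
  fixes z :: int
  assumes "\<bar>z\<bar> < int N"
  shows "(\<Sum>k<N. cis (2 * pi * (real k * z / N))) = (if z = 0 then of_nat N else 0)"
proof (cases "z = 0")
  case False
  let ?w = "cis (2 * pi * (z / N))"
  have N: "N > 0" using assms by auto
  have pw: "cis (2 * pi * (real k * z / N)) = ?w ^ k" for k
    by (simp add: Complex.DeMoivre algebra_simps)
  have "?w \<noteq> 1"
  proof
    assume "?w = 1"
    then obtain n :: int where "2 * pi * (z / N) = n * (2 * pi)" by (auto simp: cis_eq_1_iff)
    then have "real_of_int z = real_of_int (n * int N)" using N by (simp add: field_simps)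
    then have "z = n * int N" by (simp only: of_int_eq_iff)
    then show False using assms False by (simp add: abs_mult)
  qed
  moreover have "?w ^ N = cis (2 * pi * real_of_int z)" using N by (simp add: Complex.DeMoivre)
  moreover have "cis (2 * pi * real_of_int z) = 1" by (simp add: cis_multiple_2pi)
  ultimately show ?thesis unfolding pw using False by (simp add: geometric_sum)
qed simp

lemma prod_cis: "finite A \<Longrightarrow> (\<Prod>a\<in>A. cis (f a)) = cis (\<Sum>a\<in>A. f a)"
  by (induction A rule: finite_induct) (simp_all add: cis_mult)

lemma sum_prod_PiE_dflt:
  fixes f :: "'a \<Rightarrow> 'b \<Rightarrow> 'c :: comm_semiring_1"
  assumes "finite A" "\<And>x. x \<in> A \<Longrightarrow> finite (B x)"
  shows "(\<Sum>g\<in>PiE_dflt A d B. \<Prod>x\<in>A. f x (g x)) = (\<Prod>x\<in>A. \<Sum>y\<in>B x. f x y)"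
proof -
  have inj: "inj_on (\<lambda>h x. if x \<in> A then h x else d) (PiE A B)"
  proof (rule inj_onI)
    fix g h assume *: "g \<in> PiE A B" "h \<in> PiE A B"
      "(\<lambda>x. if x \<in> A then g x else d) = (\<lambda>x. if x \<in> A then h x else d)"
    show "g = h" using *(1,2)
    proof (rule PiE_ext)
      fix x assume "x \<in> A"
      then show "g x = h x" using fun_cong[OF *(3), of x] by simp
    qed
  qed
  have "(\<Sum>g\<in>PiE_dflt A d B. \<Prod>x\<in>A. f x (g x)) = (\<Sum>g\<in>PiE A B. \<Prod>x\<in>A. f x (g x))"
    unfolding dflt_image_PiE[symmetric] by (subst sum.reindex[OF inj]) (auto intro!: sum.cong prod.cong)
  then show ?thesis using prod_sum_PiE[of A B f] assms by simp
qed

definition int_comb :: "nat set \<Rightarrow> (nat \<Rightarrow> nat \<Rightarrow> int) \<Rightarrow> (nat \<Rightarrow> int) \<Rightarrow> nat \<Rightarrow> int" where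
  "int_comb P b \<theta> i = (\<Sum>r\<in>P. \<theta> r * b r i)"

text \<open>Each equation \<open>ip m (b r) x = 0\<close> is detected by a character sum modulo
  \<open>N\<close>, without loss because the values are below \<open>N\<close> in absolute value.
  After exchanging the sums, independence of the coordinates factors the average over
  \<open>x\<close>. The power of \<open>N\<close> stands on the left to avoid division.\<close>

lemma prob_kernel_fourier:
  assumes "finite P" and supp: "set_pmf p \<subseteq> {-1, 0, 1}"
    and N: "\<And>x r. (\<And>i. x i \<in> {-1, 0, 1}) \<Longrightarrow> r \<in> P \<Longrightarrow> \<bar>ip m (b r) x\<bar> < int N"
  shows "of_real (prob (Pi_pmf {..<m} 0 (\<lambda>_. p)) {x. \<forall>r\<in>P. ip m (b r) x = 0}) * of_nat N ^ card P
     = (\<Sum>\<theta>\<in>PiE P (\<lambda>_. {0..<int N}). \<Prod>i<m. char_fun p (int_comb P b \<theta> i / N))"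
proof -
  let ?Q = "Pi_pmf {..<m} 0 (\<lambda>_. p)"
  let ?V = "{-1, 0, 1} :: int set"
  define B where "B = PiE_dflt {..<m} (0::int) (\<lambda>_. ?V)"
  define E where "E = {x. \<forall>r\<in>P. ip m (b r) x = 0}"
  define \<Theta> where "\<Theta> = PiE P (\<lambda>_. {0..<int N})"
  have fB: "finite B" unfolding B_def by (intro finite_PiE_dflt) auto
  have Q: "pmf ?Q x = (\<Prod>i<m. pmf p (x i))" if "x \<in> B" for x
    using that by (subst pmf_Pi') (auto simp: B_def PiE_dflt_def)
  have "prob ?Q E = prob ?Q (E \<inter> B)"
  proof (rule measure_prob_cong_0)
    fix x assume "x \<in> E - E \<inter> B"
    then have "x \<notin> B" by auto
    then show "pmf ?Q x = 0" using supp
      by (auto simp: B_def PiE_dflt_def set_Pi_pmf subset_iff pmf_eq_0_set_pmf)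
  qed auto
  also have "\<dots> = (\<Sum>x\<in>B. pmf ?Q x * of_bool (x \<in> E))"
    using fB by (subst measure_measure_pmf_finite) (auto simp: sum.inter_restrict Int_commute intro!: sum.mono_neutral_cong_left)
  finally have "of_real (prob ?Q E) * of_nat N ^ card P
     = (\<Sum>x\<in>B. of_real (pmf ?Q x) * (of_bool (x \<in> E) * of_nat N ^ card P :: complex))"
    by (auto simp: sum_distrib_right mult.assoc intro!: sum.cong split: split_of_bool)
  also have "\<dots> = (\<Sum>x\<in>B. of_real (pmf ?Q x) * (\<Sum>\<theta>\<in>\<Theta>. \<Prod>i<m. cis (2 * pi * (int_comb P b \<theta> i / N) * of_int (x i))))"
  proof (rule sum.cong[OF refl], rule arg_cong[where f = "\<lambda>z. _ * z"])
    fix x assume "x \<in> B"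
    then have x: "x i \<in> ?V" for i by (cases "i < m") (auto simp: B_def PiE_dflt_def)
    have "(of_bool (x \<in> E) * of_nat N ^ card P :: complex) = (\<Prod>r\<in>P. if ip m (b r) x = 0 then of_nat N else 0)"
      using assms(1) by (cases "x \<in> E") (auto simp: E_def)
    also have "\<dots> = (\<Prod>r\<in>P. \<Sum>k<N. cis (2 * pi * (real k * ip m (b r) x / N)))"
      using N[OF x] by (intro prod.cong refl sum_cis_roots[symmetric]) auto
    also have "\<dots> = (\<Prod>r\<in>P. \<Sum>k\<in>{0..<int N}. cis (2 * pi * (k * ip m (b r) x / N)))"
    proof (rule prod.cong[OF refl])
      fix r
      have "{0..<int N} = int ` {..<N}" by (simp add: image_int_atLeastLessThan lessThan_atLeast0)
      then show "(\<Sum>k<N. cis (2 * pi * (real k * ip m (b r) x / N))) = (\<Sum>k\<in>{0..<int N}. cis (2 * pi * (k * ip m (b r) x / N)))"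
        by (simp add: sum.reindex)
    qed
    also have "\<dots> = (\<Sum>\<theta>\<in>\<Theta>. \<Prod>r\<in>P. cis (2 * pi * (\<theta> r * ip m (b r) x / N)))"
      unfolding \<Theta>_def by (rule prod_sum_PiE) (use assms in auto)
    also have "\<dots> = (\<Sum>\<theta>\<in>\<Theta>. \<Prod>i<m. cis (2 * pi * (int_comb P b \<theta> i / N) * of_int (x i)))"
    proof (rule sum.cong[OF refl])
      fix \<theta>
      \<comment> \<open>The phase is reorganised from rows to coordinates, so that it splits into
        one factor per \<open>x i\<close>.\<close>
      have "(\<Sum>r\<in>P. \<theta> r * ip m (b r) x) = (\<Sum>i<m. int_comb P b \<theta> i * x i)"
        using ip_sum[of m \<theta> b P x] by (simp add: ip_def int_comb_def)
      then have "(\<Sum>r\<in>P. \<theta> r * real_of_int (ip m (b r) x)) = (\<Sum>i<m. real_of_int (int_comb P b \<theta> i) * x i)"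
        by (metis (mono_tags, lifting) of_int_mult of_int_sum sum.cong)
      then have "(\<Sum>r\<in>P. 2 * pi * (\<theta> r * ip m (b r) x / N)) = (\<Sum>i<m. 2 * pi * (int_comb P b \<theta> i / N) * of_int (x i))"
        by (simp flip: sum_distrib_left sum_divide_distrib add: mult.assoc)
      then show "(\<Prod>r\<in>P. cis (2 * pi * (\<theta> r * ip m (b r) x / N))) = (\<Prod>i<m. cis (2 * pi * (int_comb P b \<theta> i / N) * of_int (x i)))"
        using assms(1) by (simp add: prod_cis)
    qed
    finally show "(of_bool (x \<in> E) * of_nat N ^ card P :: complex) = (\<Sum>\<theta>\<in>\<Theta>. \<Prod>i<m. cis (2 * pi * (int_comb P b \<theta> i / N) * of_int (x i)))" .
  qed
  also have "\<dots> = (\<Sum>x\<in>B. \<Sum>\<theta>\<in>\<Theta>. \<Prod>i<m. of_real (pmf p (x i)) * cis (2 * pi * (int_comb P b \<theta> i / N) * of_int (x i)))"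
    by (simp add: Q sum_distrib_left prod.distrib)
  also have "\<dots> = (\<Sum>\<theta>\<in>\<Theta>. \<Sum>x\<in>B. \<Prod>i<m. of_real (pmf p (x i)) * cis (2 * pi * (int_comb P b \<theta> i / N) * of_int (x i)))"
    by (rule sum.swap)
  also have "\<dots> = (\<Sum>\<theta>\<in>\<Theta>. \<Prod>i<m. char_fun p (int_comb P b \<theta> i / N))"
    unfolding B_def char_fun_def by (intro sum.cong refl sum_prod_PiE_dflt) auto
  finally show ?thesis by (simp add: E_def \<Theta>_def)
qed

section \<open>Comparison with lazy sign vectors\<close>

text \<open>These vectors represent sparse residue vectors modulo 2. Fixing the entries from
  \<open>m\<close> on makes the representative unique and the set finite.\<close>

definition sparse :: "nat \<Rightarrow> real \<Rightarrow> (nat \<Rightarrow> int) set" where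
  "sparse m k = {w. (\<forall>i. w i \<in> {0, 1}) \<and> (\<forall>i\<ge>m. w i = 0) \<and> real_of_int (\<Sum>i<m. w i) \<le> k}"

abbreviation random_vec :: "nat \<Rightarrow> int pmf \<Rightarrow> (nat \<Rightarrow> int) pmf" where
  "random_vec m p \<equiv> Pi_pmf {..<m} 0 (\<lambda>_. p)"

lemma finite_sparse: "finite (sparse m k)"
proof -
  have "sparse m k \<subseteq> PiE_dflt {..<m} 0 (\<lambda>_. {0, 1})"
    by (auto simp: sparse_def PiE_dflt_def)
  then show ?thesis by (rule finite_subset) (auto intro!: finite_PiE_dflt)
qed

abbreviation sn :: "real \<Rightarrow> real" where
  "sn t \<equiv> (sin (pi * t))\<^sup>2"

lemma sn_add_int: "sn (t + of_int k) = sn t"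
proof -
  have "cos (2 * (pi * (t + of_int k))) = cos (2 * (pi * t) + 2 * pi * of_int k)"
    by (simp add: algebra_simps)
  also have "\<dots> = cos (2 * (pi * t))"
    by (simp only: cos_add cos_int_2pin sin_int_2pin mult_1_right mult_zero_right diff_zero)
  finally show ?thesis by (simp add: cos_double_sin)
qed

text \<open>At half-integers \<open>sn\<close> is a parity, so a small sum of such values says that
  few of the integers are odd.\<close>

lemma sn_half_int: "sn (of_int z / 2) = of_int (z mod 2)"
proof -
  have "z = z mod 2 + 2 * (z div 2)" by simp
  then have "of_int z / 2 = of_int (z mod 2) / 2 + real_of_int (z div 2)" by linarith
  then have "sn (of_int z / 2) = sn (of_int (z mod 2) / 2)" by (simp only: sn_add_int)
  moreover have "z mod 2 = 0 \<or> z mod 2 = 1" by auto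
  ultimately show ?thesis by auto
qed

text \<open>The addition theorem bounds \<bar>sin (x - y)\<bar> by \<bar>sin x\<bar> + \<bar>sin
  y\<bar>, and (a + b)^2 \<le> 2 (a^2 + b^2). This serves to compare two frequencies in one
  fibre.\<close>

lemma sn_diff_le: "sn (s - t) \<le> 2 * (sn s + sn t)"
proof -
  let ?a = "sin (pi * s)" and ?b = "sin (pi * t)" and ?c = "cos (pi * s)" and ?d = "cos (pi * t)"
  have "\<bar>?a * ?d - ?c * ?b\<bar> \<le> \<bar>?a\<bar> * \<bar>?d\<bar> + \<bar>?c\<bar> * \<bar>?b\<bar>"
    by (metis abs_mult abs_triangle_ineq4)
  also have "\<dots> \<le> \<bar>?a\<bar> * 1 + 1 * \<bar>?b\<bar>" by (intro add_mono mult_mono) auto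
  finally have "\<bar>sin (pi * (s - t))\<bar> \<le> \<bar>?a\<bar> + \<bar>?b\<bar>"
    by (simp add: right_diff_distrib sin_diff)
  then have "sn (s - t) \<le> (\<bar>?a\<bar> + \<bar>?b\<bar>)\<^sup>2" by (metis abs_ge_zero power2_abs power_mono)
  also have "\<dots> \<le> 2 * (\<bar>?a\<bar>\<^sup>2 + \<bar>?b\<bar>\<^sup>2)"
    using zero_le_power2[of "\<bar>?a\<bar> - \<bar>?b\<bar>"] by (simp add: power2_sum power2_diff)
  finally show ?thesis by simp
qed

lemma sn_double_le: "sn (2 * t) \<le> 4 * sn t"
proof -
  have "sn (2 * t) = 4 * sn t * (cos (pi * t))\<^sup>2"
    using sin_double[of "pi * t"] by (simp add: power_mult_distrib algebra_simps)
  also have "\<dots> \<le> 4 * sn t * 1" by (intro mult_left_mono) (auto simp: abs_square_le_1)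
  finally show ?thesis by simp
qed

lemma sn_le_1: "sn t \<le> 1"
  by (simp add: abs_square_le_1)

lemma int_comb_diff: "int_comb P b \<theta> i - int_comb P b \<theta>' i = int_comb P b (\<lambda>r. \<theta> r - \<theta>' r) i"
  by (simp add: int_comb_def sum_subtractf left_diff_distrib)

lemma int_comb_scale: "int_comb P b (\<lambda>r. c * \<theta> r) i = c * int_comb P b \<theta> i"
  by (simp add: int_comb_def sum_distrib_left mult.assoc)

text \<open>
  Two frequencies in the same fibre differ by \<open>M\<close> times an integer vector, whose combination of
  the rows of \<open>b\<close>, reduced modulo 2, is a sparse annihilator of \<open>V\<close>.  That \<open>D\<close> is odd makes this
  map injective.
\<close>

lemma fibre_card_le:
  fixes M :: nat and a :: real
  assumes M: "M > 0" and piv: "pivots m (ann m S) P D b"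
  defines "K \<equiv> {w \<in> sparse m (4 * a * m). \<forall>x\<in>{x. \<forall>r\<in>P. ip m (b r) x = 0}. even (ip m w x)}"
  shows "card {\<theta> \<in> PiE P (\<lambda>_. {0..<int (2 * M)}). (\<Sum>i<m. sn (int_comb P b \<theta> i / (2 * M))) < a * m \<and>
      (\<lambda>r\<in>P. \<theta> r mod int M) = \<phi>} \<le> card K" (is "card ?F \<le> _")
proof (cases "?F = {}")
  case False
  then obtain \<tau> where \<tau>: "\<tau> \<in> ?F" by blast
  define \<zeta> where "\<zeta> \<theta> r = (\<theta> r - \<tau> r) div int M" for \<theta> :: "nat \<Rightarrow> int" and r
  define \<omega> where "\<omega> \<theta> i = (if i < m then int_comb P b (\<zeta> \<theta>) i mod 2 else 0)" for \<theta> i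
  have \<zeta>: "\<theta> r - \<tau> r = int M * \<zeta> \<theta> r" if "\<theta> \<in> ?F" "r \<in> P" for \<theta> r
  proof -
    have "(\<lambda>r\<in>P. \<theta> r mod int M) = (\<lambda>r\<in>P. \<tau> r mod int M)" using that \<tau> by simp
    from fun_cong[OF this, of r] have "\<theta> r mod int M = \<tau> r mod int M" using that by simp
    then have "int M dvd \<theta> r - \<tau> r" by (simp add: mod_eq_dvd_iff)
    then show ?thesis by (simp add: \<zeta>_def)
  qed
  have int_comb\<zeta>: "int_comb P b \<theta> i - int_comb P b \<tau> i = int M * int_comb P b (\<zeta> \<theta>) i" if "\<theta> \<in> ?F" for \<theta> i
    unfolding int_comb_diff int_comb_scale[symmetric] unfolding int_comb_def
    using \<zeta>[OF that] by (intro sum.cong) auto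
  have "inj_on \<omega> ?F"
  proof (rule inj_onI)
    fix \<theta> \<theta>' assume t: "\<theta> \<in> ?F" "\<theta>' \<in> ?F" "\<omega> \<theta> = \<omega> \<theta>'"
    have "\<theta> r = \<theta>' r" if r: "r \<in> P" for r
    proof -
      have "r < m" using r piv by (auto simp: pivots_def)
      moreover have "int_comb P b z r = z r * D" for z
      proof -
        have "int_comb P b z r = (\<Sum>s\<in>P. if s = r then z s * D else 0)"
          unfolding int_comb_def using piv r by (intro sum.cong) (auto simp: pivots_def)
        then show ?thesis using r piv finite_subset[of P "{..<m}"] by (simp add: pivots_def)
      qed
      ultimately have "(\<zeta> \<theta> r * D) mod 2 = (\<zeta> \<theta>' r * D) mod 2"
        using fun_cong[OF t(3), of r] by (simp add: \<omega>_def)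
      then have "even (\<zeta> \<theta> r * D) \<longleftrightarrow> even (\<zeta> \<theta>' r * D)" by (simp add: even_iff_mod_2_eq_zero)
      then have "even (\<zeta> \<theta> r - \<zeta> \<theta>' r)" using piv by (simp add: pivots_def)
      then obtain k where k: "\<zeta> \<theta> r - \<zeta> \<theta>' r = 2 * k" by (rule evenE)
      \<comment> \<open>Quotients of equal parity make the frequencies congruent modulo
        \<open>2 * M\<close>; as both lie in \<open>{0..<int (2 * M)}\<close>, they agree.\<close>
      have "\<theta> r - \<theta>' r = int M * (\<zeta> \<theta> r - \<zeta> \<theta>' r)"
        using \<zeta>[OF t(1) r] \<zeta>[OF t(2) r] by (simp add: algebra_simps)
      then have e: "\<theta> r - \<theta>' r = int (2 * M) * k" using k by simp
      moreover have "\<theta> r \<in> {0..<int (2 * M)}" "\<theta>' r \<in> {0..<int (2 * M)}" using t r by auto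
      ultimately have "\<bar>int (2 * M) * k\<bar> < int (2 * M)" by auto
      then have "k = 0" using M by (simp add: abs_mult)
      then show ?thesis using e by simp
    qed
    then show "\<theta> = \<theta>'" using t by (auto intro: PiE_ext)
  qed
  moreover have "\<omega> ` ?F \<subseteq> K"
  proof (rule image_subsetI)
    fix \<theta> assume t: "\<theta> \<in> ?F"
    \<comment> \<open>The odd entries of the combination of \<open>\<zeta> \<theta>\<close> are
      counted by \<open>sn\<close> at their halves, which are the differences of the two phases.
      Both sine sums are below \<open>a * m\<close>, hence the bound
      \<open>4 * a * m\<close>.\<close>
    have "real_of_int (\<Sum>i<m. \<omega> \<theta> i) = (\<Sum>i<m. sn (int_comb P b \<theta> i / (2 * M) - int_comb P b \<tau> i / (2 * M)))"
    proof (simp only: of_int_sum, rule sum.cong[OF refl])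
      fix i assume "i \<in> {..<m}"
      then have "real_of_int (\<omega> \<theta> i) = sn (int_comb P b (\<zeta> \<theta>) i / 2)" 
        by (simp only: \<omega>_def sn_half_int lessThan_iff if_True)
      also have "int_comb P b (\<zeta> \<theta>) i / 2 = int_comb P b \<theta> i / (2 * M) - int_comb P b \<tau> i / (2 * M)"
      proof -
        have "real_of_int (int_comb P b \<theta> i) - int_comb P b \<tau> i = M * int_comb P b (\<zeta> \<theta>) i"
          using arg_cong[OF int_comb\<zeta>[OF t, of i], of real_of_int] by simp
        then show ?thesis using M by (simp add: field_simps)
      qed
      finally show "real_of_int (\<omega> \<theta> i) = sn (int_comb P b \<theta> i / (2 * M) - int_comb P b \<tau> i / (2 * M))" .
    qed
    also have "\<dots> \<le> (\<Sum>i<m. 2 * (sn (int_comb P b \<theta> i / (2 * M)) + sn (int_comb P b \<tau> i / (2 * M))))"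
      by (intro sum_mono sn_diff_le)
    also have "\<dots> = 2 * ((\<Sum>i<m. sn (int_comb P b \<theta> i / (2 * M))) + (\<Sum>i<m. sn (int_comb P b \<tau> i / (2 * M))))"
      by (simp add: sum_distrib_left sum.distrib)
    also have "\<dots> \<le> 2 * (a * m + a * m)" using t \<tau> by (intro mult_left_mono add_mono) auto
    finally have "\<omega> \<theta> \<in> sparse m (4 * a * m)" by (auto simp: sparse_def \<omega>_def)
    moreover have "even (ip m (\<omega> \<theta>) x)" if "\<forall>r\<in>P. ip m (b r) x = 0" for x
    proof -
      have "ip m (\<omega> \<theta>) x = (\<Sum>i<m. int_comb P b (\<zeta> \<theta>) i * x i - 2 * (int_comb P b (\<zeta> \<theta>) i div 2 * x i))"
        unfolding ip_def by (intro sum.cong) (simp_all add: \<omega>_def minus_mult_div_eq_mod[symmetric] algebra_simps)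
      also have "\<dots> = (\<Sum>i<m. int_comb P b (\<zeta> \<theta>) i * x i) - 2 * (\<Sum>i<m. int_comb P b (\<zeta> \<theta>) i div 2 * x i)"
        by (simp add: sum_subtractf sum_distrib_left)
      also have "(\<Sum>i<m. int_comb P b (\<zeta> \<theta>) i * x i) = 0"
        using ip_sum[of m "\<zeta> \<theta>" b P x] that by (simp add: ip_def int_comb_def)
      finally show ?thesis by simp
    qed
    ultimately show "\<omega> \<theta> \<in> K" by (simp add: K_def)
  qed
  ultimately show ?thesis using finite_sparse by (intro card_inj_on_le) (auto simp: K_def)
qed (simp only: card.empty zero_le)

text \<open>Fourier inversion is applied to the Bernoulli law modulo \<open>2 * M\<close> and to the
  lazy sign law modulo \<open>M\<close>. Frequencies with a large sine sum give the exponential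
  term; the others are grouped by their residues modulo \<open>M\<close>, and no group is larger
  than the set of sparse annihilators modulo 2.\<close>

lemma ratio_bound:
  fixes a q :: real
  assumes q: "0 < q" "q < 1" and piv: "pivots m (ann m S) P D b"
    and V: "V = {x. \<forall>r\<in>P. ip m (b r) x = 0}"
  defines "\<mu> \<equiv> q * (1 - q) / 4"
  shows "prob (random_vec m (bernoulli_int q)) V \<le> exp (- 8 * \<mu> * a * m)
     + card {w \<in> sparse m (4 * a * m). \<forall>x\<in>V. even (ip m w x)} / 2 ^ card P * prob (random_vec m (lazy_sign \<mu>)) V"
proof -
  define K where "K = {w \<in> sparse m (4 * a * m). \<forall>x\<in>V. even (ip m w x)}"
  have finP: "finite P" using piv finite_subset by (auto simp: pivots_def)
  \<comment> \<open>\<open>M\<close> exceeds \<open>\<bar>ip m (b r) x\<bar>\<close> whenever the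
    entries of \<open>x\<close> lie in \<open>{-1, 0, 1}\<close>, so both \<open>M\<close> and
    \<open>N\<close> are admissible moduli. The added 1 makes the inequality strict and
    \<open>M\<close> positive.\<close>
  define M where "M = nat (\<Sum>r\<in>P. \<Sum>i<m. \<bar>b r i\<bar>) + 1"
  define N where "N = 2 * M"
  define d where "d = card P"
  have M: "0 < M" by (simp add: M_def)
  have \<mu>: "0 \<le> \<mu>" "\<mu> \<le> 1/16"
  proof -
    have "q * (1 - q) \<le> 1 / 4" using zero_le_power2[of "q - 1/2"] by (simp add: power2_eq_square algebra_simps)
    then show "\<mu> \<le> 1/16" by (simp add: \<mu>_def)
    show "0 \<le> \<mu>" using q by (simp add: \<mu>_def)
  qed
  have ipM: "\<bar>ip m (b r) x\<bar> < int M" if "\<And>i. x i \<in> {-1, 0, 1}" "r \<in> P" for x r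
  proof -
    have "\<bar>ip m (b r) x\<bar> \<le> (\<Sum>i<m. \<bar>b r i * x i\<bar>)" unfolding ip_def by (rule sum_abs)
    also have "\<dots> \<le> (\<Sum>i<m. \<bar>b r i\<bar>)"
    proof (rule sum_mono)
      fix i show "\<bar>b r i * x i\<bar> \<le> \<bar>b r i\<bar>" using that(1)[of i] by (auto simp: abs_mult)
    qed
    also have "\<dots> \<le> (\<Sum>r\<in>P. \<Sum>i<m. \<bar>b r i\<bar>)"
      using finP that(2) by (intro member_le_sum) (auto intro: sum_nonneg)
    also have "\<dots> < int M" by (simp add: M_def sum_nonneg)
    finally show ?thesis .
  qed
  then have ipN: "\<bar>ip m (b r) x\<bar> < int N" if "\<And>i. x i \<in> {-1, 0, 1}" "r \<in> P" for x r
  proof -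
    have "\<bar>ip m (b r) x\<bar> < int M" by (rule ipM) (fact that)+
    then show ?thesis by (simp add: N_def)
  qed
  define \<Theta> where "\<Theta> k = PiE P (\<lambda>_. {0..<int k})" for k
  have fin\<Theta>: "finite (\<Theta> k)" and card\<Theta>: "card (\<Theta> k) = k ^ d" for k
    using finP by (auto simp: \<Theta>_def d_def card_PiE intro!: finite_PiE)
  define G where "G \<theta> = (\<Prod>i<m. 1 - 2 * \<mu> * sn (int_comb P b \<theta> i / M))" for \<theta>
  have Gnn: "0 \<le> G \<theta>" for \<theta>
  proof -
    have "2 * \<mu> * sn t \<le> 1 * 1" for t using \<mu> sn_le_1 by (intro mult_mono) auto
    then have "0 \<le> 1 - 2 * \<mu> * sn t" for t by simp
    then show ?thesis unfolding G_def by (intro prod_nonneg ballI)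
  qed
  have lazyG: "prob (random_vec m (lazy_sign \<mu>)) V * real M ^ d = (\<Sum>\<theta>\<in>\<Theta> M. G \<theta>)"
  proof -
    have "complex_of_real (prob (random_vec m (lazy_sign \<mu>)) V * real M ^ d) = complex_of_real (\<Sum>\<theta>\<in>\<Theta> M. G \<theta>)"
      using prob_kernel_fourier[OF finP set_lazy_sign[of \<mu>] ipM] \<mu>
      by (simp add: V \<Theta>_def d_def G_def char_fun_lazy_sign)
    then show ?thesis by (simp only: of_real_eq_iff)
  qed
  \<comment> \<open>\<open>F\<close> dominates the modulus of the Bernoulli product, as 2 q (1 - q)
    = 8 \<mu>; its factors are nonnegative because 8 \<mu> \<le> 1/2.\<close>
  define F where "F \<theta> = (\<Prod>i<m. 1 - 8 * \<mu> * sn (int_comb P b \<theta> i / N))" for \<theta>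
  have Fterm: "0 \<le> 1 - 8 * \<mu> * sn t" for t
  proof -
    have "8 * \<mu> * sn t \<le> 1 * 1" using \<mu> sn_le_1 by (intro mult_mono) auto
    then show ?thesis by simp
  qed
  have "prob (random_vec m (bernoulli_int q)) V * real N ^ d \<le> (\<Sum>\<theta>\<in>\<Theta> N. F \<theta>)"
  proof -
    have "prob (random_vec m (bernoulli_int q)) V * real N ^ d = norm (complex_of_real (prob (random_vec m (bernoulli_int q)) V) * of_nat N ^ d)"
      by (simp add: norm_mult norm_power)
    also have "complex_of_real (prob (random_vec m (bernoulli_int q)) V) * of_nat N ^ d = (\<Sum>\<theta>\<in>\<Theta> N. \<Prod>i<m. char_fun (bernoulli_int q) (int_comb P b \<theta> i / N))"
      unfolding V \<Theta>_def d_def using set_bernoulli_int[of q] by (intro prob_kernel_fourier[OF finP _ ipN]) auto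
    also have "norm \<dots> \<le> (\<Sum>\<theta>\<in>\<Theta> N. \<Prod>i<m. norm (char_fun (bernoulli_int q) (int_comb P b \<theta> i / N)))"
      by (rule order_trans[OF norm_sum]) (simp add: prod_norm)
    also have "\<dots> \<le> (\<Sum>\<theta>\<in>\<Theta> N. F \<theta>)"
      unfolding F_def
    proof (intro sum_mono prod_mono conjI)
      fix \<theta> i show "norm (char_fun (bernoulli_int q) (int_comb P b \<theta> i / N)) \<le> 1 - 8 * \<mu> * sn (int_comb P b \<theta> i / N)"
        using norm_char_fun_bernoulli_int[of q "int_comb P b \<theta> i / N"] q by (simp add: \<mu>_def)
    qed auto
    finally show ?thesis .
  qed
  also have "(\<Sum>\<theta>\<in>\<Theta> N. F \<theta>) \<le> real N ^ d * exp (- 8 * \<mu> * a * m) + card K * (\<Sum>\<theta>\<in>\<Theta> M. G \<theta>)"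
  proof -
    let ?small = "\<lambda>\<theta>. (\<Sum>i<m. sn (int_comb P b \<theta> i / N)) < a * m"
    let ?A = "{\<theta>\<in>\<Theta> N. \<not> ?small \<theta>}" and ?B = "{\<theta>\<in>\<Theta> N. ?small \<theta>}"
    let ?\<rho> = "\<lambda>\<theta>. \<lambda>r\<in>P. \<theta> r mod int M"
    have "(\<Sum>\<theta>\<in>\<Theta> N. F \<theta>) = (\<Sum>\<theta>\<in>?A \<union> ?B. F \<theta>)" by (intro sum.cong) auto
    also have "\<dots> = (\<Sum>\<theta>\<in>?A. F \<theta>) + (\<Sum>\<theta>\<in>?B. F \<theta>)"
      using fin\<Theta> by (intro sum.union_disjoint) auto
    finally have split: "(\<Sum>\<theta>\<in>\<Theta> N. F \<theta>) = (\<Sum>\<theta>\<in>?A. F \<theta>) + (\<Sum>\<theta>\<in>?B. F \<theta>)" .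
    have "(\<Sum>\<theta>\<in>?A. F \<theta>) \<le> (\<Sum>\<theta>\<in>?A. exp (- 8 * \<mu> * a * m))"
    proof (rule sum_mono)
      fix \<theta> assume "\<theta> \<in> ?A"
      then have big: "a * m \<le> (\<Sum>i<m. sn (int_comb P b \<theta> i / N))" by simp
      have "F \<theta> \<le> (\<Prod>i<m. exp (- (8 * \<mu> * sn (int_comb P b \<theta> i / N))))"
        unfolding F_def
      proof (intro prod_mono conjI)
        fix i show "1 - 8 * \<mu> * sn (int_comb P b \<theta> i / N) \<le> exp (- (8 * \<mu> * sn (int_comb P b \<theta> i / N)))"
          using exp_ge_add_one_self[of "- (8 * \<mu> * sn (int_comb P b \<theta> i / N))"] by simp
      qed (rule Fterm)
      also have "\<dots> = exp (- (8 * \<mu> * (\<Sum>i<m. sn (int_comb P b \<theta> i / N))))"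
        by (simp add: exp_sum[symmetric] sum_negf sum_distrib_left)
      also have "\<dots> \<le> exp (- 8 * \<mu> * a * m)"
        using mult_left_mono[OF big, of "8 * \<mu>"] \<mu> by (simp add: mult.assoc)
      finally show "F \<theta> \<le> exp (- 8 * \<mu> * a * m)" .
    qed
    also have "\<dots> \<le> real N ^ d * exp (- 8 * \<mu> * a * m)"
    proof -
      have "card ?A \<le> N ^ d" unfolding card\<Theta>[symmetric] using fin\<Theta> by (intro card_mono) auto
      then have "real (card ?A) \<le> real (N ^ d)" by (rule of_nat_mono)
      then show ?thesis by (simp add: mult_right_mono)
    qed
    finally have A: "(\<Sum>\<theta>\<in>?A. F \<theta>) \<le> real N ^ d * exp (- 8 * \<mu> * a * m)" .
    have "(\<Sum>\<theta>\<in>?B. F \<theta>) \<le> (\<Sum>\<theta>\<in>?B. G (?\<rho> \<theta>))"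
    proof (rule sum_mono)
      fix \<theta>
      have "F \<theta> \<le> G \<theta>" unfolding F_def G_def
      proof (intro prod_mono conjI)
        fix i
        \<comment> \<open>Passing from the modulus \<open>N\<close> to \<open>M\<close> doubles the
          frequency, which multiplies \<open>sn\<close> by at most 4; this matches the factors 8
          \<mu> and 2 \<mu>.\<close>
        have "sn (int_comb P b \<theta> i / M) \<le> 4 * sn (int_comb P b \<theta> i / N)"
          using sn_double_le[of "int_comb P b \<theta> i / N"] M by (simp add: N_def)
        then have "2 * \<mu> * sn (int_comb P b \<theta> i / M) \<le> 2 * \<mu> * (4 * sn (int_comb P b \<theta> i / N))"
          using \<mu> by (intro mult_left_mono) auto
        then show "1 - 8 * \<mu> * sn (int_comb P b \<theta> i / N) \<le> 1 - 2 * \<mu> * sn (int_comb P b \<theta> i / M)" by simp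
      qed (rule Fterm)
      \<comment> \<open>Reducing \<open>\<theta>\<close> modulo \<open>M\<close> shifts each phase
        by an integer, and \<open>sn\<close> has period 1.\<close>
      also have "G \<theta> = G (?\<rho> \<theta>)" unfolding G_def
      proof (rule prod.cong[OF refl])
        fix i
        have "int_comb P b \<theta> i - int_comb P b (?\<rho> \<theta>) i = int M * int_comb P b (\<lambda>r. \<theta> r div int M) i"
          unfolding int_comb_diff int_comb_scale[symmetric] unfolding int_comb_def
          by (intro sum.cong) (simp_all add: minus_mod_eq_mult_div)
        then have "real_of_int (int_comb P b \<theta> i) = int_comb P b (?\<rho> \<theta>) i + M * real_of_int (int_comb P b (\<lambda>r. \<theta> r div int M) i)"
          using arg_cong[of _ _ real_of_int] by fastforce
        then have "int_comb P b \<theta> i / M = int_comb P b (?\<rho> \<theta>) i / M + of_int (int_comb P b (\<lambda>r. \<theta> r div int M) i)"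
          using M by (simp add: field_simps)
        then show "1 - 2 * \<mu> * sn (int_comb P b \<theta> i / M) = 1 - 2 * \<mu> * sn (int_comb P b (?\<rho> \<theta>) i / M)"
          by (simp only: sn_add_int)
      qed
      finally show "F \<theta> \<le> G (?\<rho> \<theta>)" .
    qed
    also have "\<dots> = (\<Sum>\<phi>\<in>\<Theta> M. \<Sum>\<theta>\<in>{\<theta>\<in>?B. ?\<rho> \<theta> = \<phi>}. G (?\<rho> \<theta>))"
      using fin\<Theta> M by (intro sum.group[symmetric]) (auto simp: \<Theta>_def)
    also have "\<dots> = (\<Sum>\<phi>\<in>\<Theta> M. card {\<theta>\<in>?B. ?\<rho> \<theta> = \<phi>} * G \<phi>)"
      by simp
    also have "\<dots> \<le> (\<Sum>\<phi>\<in>\<Theta> M. card K * G \<phi>)"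
    proof (intro sum_mono mult_right_mono Gnn of_nat_mono)
      fix \<phi>
      show "card {\<theta>\<in>?B. ?\<rho> \<theta> = \<phi>} \<le> card K"
        using fibre_card_le[OF M piv, of a \<phi>] by (simp add: K_def V \<Theta>_def N_def)
    qed
    also have "\<dots> = card K * (\<Sum>\<theta>\<in>\<Theta> M. G \<theta>)" by (simp add: sum_distrib_left)
    finally have "(\<Sum>\<theta>\<in>?B. F \<theta>) \<le> card K * (\<Sum>\<theta>\<in>\<Theta> M. G \<theta>)" .
    with A show ?thesis unfolding split by (rule add_mono)
  qed
  \<comment> \<open>The identity N^d = 2^d M^d produces the gain 2^(-d) over the lazy sign
    law.\<close>
  also have "\<dots> = (exp (- 8 * \<mu> * a * m) + card K / 2 ^ d * prob (random_vec m (lazy_sign \<mu>)) V) * real N ^ d"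
    unfolding lazyG[symmetric] by (simp add: N_def power_mult_distrib field_simps)
  finally show ?thesis
    using M by (simp add: K_def d_def N_def)
qed

section \<open>Square matrices of low rank\<close>

text \<open>An exponential Markov bound: a 0/1 vector with j ones gets the weight z^j, which is at
  least z^k on sparse vectors since z \<le> 1, and the weights of all 0/1 vectors add up to (1 +
  z)^m.\<close>

lemma card_sparse_le:
  fixes z k :: real
  assumes z: "0 < z" "z \<le> 1"
  shows "card (sparse m k) * z powr k \<le> (1 + z) ^ m"
proof -
  let ?B = "PiE_dflt {..<m} 0 (\<lambda>_. {0, 1}) :: (nat \<Rightarrow> int) set"
  let ?f = "\<lambda>w. \<Prod>i<m. if w i = 1 then z else 1" 
  have w: "z powr k \<le> ?f w" if "w \<in> sparse m k" for w :: "nat \<Rightarrow> int"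
  proof -
    have "?f w = (\<Prod>i<m. z powr of_int (w i))"
    proof (rule prod.cong[OF refl])
      fix i have "w i = 0 \<or> w i = 1" using that by (auto simp: sparse_def)
      then show "(if w i = 1 then z else 1) = z powr of_int (w i)" using z by auto
    qed
    also have "\<dots> = z powr of_int (\<Sum>i<m. w i)" using z by (simp add: powr_sum)
    finally show ?thesis using that z by (auto simp: sparse_def intro!: powr_mono')
  qed
  have "card (sparse m k) * z powr k = (\<Sum>w\<in>sparse m k. z powr k)" by simp
  also have "\<dots> \<le> (\<Sum>w\<in>sparse m k. ?f w)" using w by (rule sum_mono)
  also have "\<dots> \<le> (\<Sum>w\<in>?B. ?f w)"
    using z by (intro sum_mono2 finite_PiE_dflt prod_nonneg) (auto simp: sparse_def PiE_dflt_def)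
  also have "\<dots> = (\<Prod>i<m. \<Sum>a\<in>{0, 1 :: int}. if a = 1 then z else 1)"
    by (rule sum_prod_PiE_dflt) auto
  also have "\<dots> = (1 + z) ^ m" by (simp add: add.commute)
  finally show ?thesis .
qed

text \<open>First \<open>z\<close> is taken so small that (1 + z)^m \<le> exp (l m / 2), then
  \<open>k\<close> so small that the factor z^(-k m) is at most exp (l m / 2).\<close>

lemma card_sparse_le_exp:
  fixes l :: real
  assumes "0 < l"
  obtains k where "0 < k" "k \<le> 1/8" "\<And>m. real (card (sparse m (k * m))) \<le> exp (l * m)"
proof -
  define z where "z = min (1/2) (l / 2)"
  have z: "0 < z" "z < 1" "z \<le> l / 2" using assms by (auto simp: z_def)
  have lz: "0 < - ln z" using z by simp
  define k where "k = min (1/8) (l / (2 * (- ln z)))"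
  have "0 < l / (2 * (- ln z))" using lz assms by (intro divide_pos_pos) auto
  then have k: "0 < k" "k \<le> 1/8" by (auto simp: k_def)
  have "k \<le> l / (2 * (- ln z))" by (simp add: k_def)
  then have kz: "k * (- ln z) \<le> l / 2" using lz by (simp only: pos_le_divide_eq[of "2 * (- ln z)"] mult_pos_pos zero_less_numeral)
  have "real (card (sparse m (k * m))) \<le> exp (l * m)" for m
  proof -
    have "card (sparse m (k * m)) * z powr (k * m) \<le> (1 + z) ^ m"
      using z by (intro card_sparse_le) auto
    also have "\<dots> \<le> exp z ^ m" using z by (intro power_mono exp_ge_add_one_self) auto
    also have "\<dots> = exp (z * m)" by (simp add: exp_of_nat2_mult)
    finally have "card (sparse m (k * m)) * exp (k * m * ln z) \<le> exp (z * m)" using z by (simp add: powr_def)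
    then have "card (sparse m (k * m)) \<le> exp (z * m) / exp (k * m * ln z)"
      by (simp add: pos_le_divide_eq)
    also have "\<dots> = exp ((z + k * (- ln z)) * m)" by (simp flip: exp_diff add: algebra_simps)
    also have "\<dots> \<le> exp (l * m)"
      using mult_right_mono[OF add_mono[OF z(3) kz], of "real m"] by simp
    finally show ?thesis .
  qed
  then show ?thesis using that k by blast
qed

text \<open>Modulo 2 the rows of \<open>b\<close> form the identity on \<open>P\<close>, so the
  coordinates outside \<open>P\<close> determine the parity of each pivot coordinate, and the parity
  determines a 0/1 entry. Hence each pivot gains one factor \<open>max q (1 - q)\<close>.\<close>

lemma prob_even_le:
  assumes q: "0 < q" "q < 1" and P: "P \<subseteq> {..<m}"
    and b: "\<And>p r. p \<in> P \<Longrightarrow> r \<in> P \<Longrightarrow> odd (b p r) \<longleftrightarrow> p = r"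
    and E: "\<And>x p. x \<in> E \<Longrightarrow> p \<in> P \<Longrightarrow> even (ip m (b p) x)"
  shows "prob (random_vec m (bernoulli_int q)) E \<le> max q (1 - q) ^ card P"
proof -
  let ?E = "E \<inter> {x. \<forall>i<m. x i \<in> {0, 1}}"
  have fP: "finite P" using P finite_subset by auto
  have "prob (random_vec m (bernoulli_int q)) E = prob (random_vec m (bernoulli_int q)) (E \<inter> set_pmf (random_vec m (bernoulli_int q)))"
    by (simp add: measure_Int_set_pmf)
  also have "\<dots> \<le> prob (random_vec m (bernoulli_int q)) ?E"
    using set_bernoulli_int[of q] by (intro measure_pmf.finite_measure_mono) (auto simp: set_Pi_pmf PiE_dflt_def)
  also have "\<dots> \<le> max q (1 - q) ^ (card {..<m} - card ({..<m} - P))"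
  proof (rule prob_determined_le)
    fix x y i assume x: "x \<in> ?E" and y: "y \<in> ?E" and e: "\<And>i. i \<in> {..<m} - P \<Longrightarrow> x i = y i" and i: "i \<in> {..<m}"
    show "x i = y i"
    proof (cases "i \<in> P")
      case True
      have "ip m (b i) x - ip m (b i) y = (\<Sum>j<m. b i j * (x j - y j))"
        by (simp add: ip_def algebra_simps sum_subtractf)
      also have "\<dots> = b i i * (x i - y i) + (\<Sum>j\<in>{..<m} - {i}. b i j * (x j - y j))"
        using i by (simp add: sum.remove)
      finally have "b i i * (x i - y i) = ip m (b i) x - ip m (b i) y - (\<Sum>j\<in>{..<m} - {i}. b i j * (x j - y j))"
        by simp
      moreover have "even (\<Sum>j\<in>{..<m} - {i}. b i j * (x j - y j))"
      proof (rule dvd_sum)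
        fix j assume j: "j \<in> {..<m} - {i}"
        show "even (b i j * (x j - y j))" using b[OF True, of j] e[of j] j by (cases "j \<in> P") auto
      qed
      moreover have "even (ip m (b i) x)" "even (ip m (b i) y)" using E x y True by auto
      ultimately have "even (b i i * (x i - y i))" by simp
      then have "even (x i - y i)" using b[OF True True] by simp
      moreover have "x i = 0 \<or> x i = 1" "y i = 0 \<or> y i = 1" using x y i by auto
      ultimately show ?thesis by auto
    qed (use e i in auto)
  qed (use q in \<open>auto simp: pmf_bernoulli_int\<close>)
  also have "card {..<m} - card ({..<m} - P) = card P"
    using P fP card_mono[of "{..<m}" P] by (simp add: card_Diff_subset)
  finally show ?thesis .
qed

text \<open>More than \<open>2 ^ l\<close> sparse annihilators contain \<open>l\<close> that are
  independent modulo 2. The union bound runs over such tuples; for a fixed tuple every column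
  satisfies \<open>l\<close> independent parity conditions.\<close>

lemma prob_many_sparse_le:
  assumes q: "0 < q" "q < 1" and S: "finite S"
  shows "prob (Pi_pmf S d (\<lambda>_. random_vec m (bernoulli_int q)))
      {X. 2 ^ l < card {w \<in> sparse m k. \<forall>j\<in>S. even (ip m w (X j))}}
    \<le> real (card (sparse m k)) ^ l * (max q (1 - q) ^ l) ^ card S"
proof -
  define \<F> where "\<F> = {f \<in> {..<l} \<rightarrow>\<^sub>E sparse m k. \<exists>P b. P \<subseteq> {..<m} \<and> card P = l \<and>
     (\<forall>p\<in>P. \<forall>r\<in>P. odd (b p r) \<longleftrightarrow> p = r) \<and>
     (\<forall>x. (\<forall>j<l. even (ip m (f j) x)) \<longrightarrow> (\<forall>p\<in>P. even (ip m (b p) x)))}"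
  let ?E = "\<lambda>f. {x. \<forall>j<l. even (ip m (f j) x)}"
  let ?Q = "Pi_pmf S d (\<lambda>_. random_vec m (bernoulli_int q))"
  have fin: "finite ({..<l} \<rightarrow>\<^sub>E sparse m k)" using finite_sparse by (intro finite_PiE) auto
  then have finF: "finite \<F>" by (simp add: \<F>_def)
  have "card \<F> \<le> card ({..<l} \<rightarrow>\<^sub>E sparse m k)"
    using fin by (intro card_mono) (auto simp: \<F>_def)
  then have cardF: "real (card \<F>) \<le> real (card (sparse m k)) ^ l" 
    by (metis card_funcsetE card_lessThan finite_lessThan of_nat_le_iff of_nat_power)
  have "prob ?Q {X. 2 ^ l < card {w \<in> sparse m k. \<forall>j\<in>S. even (ip m w (X j))}}
      \<le> prob ?Q (\<Union>f\<in>\<F>. {X. X ` S \<subseteq> ?E f})"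
  proof (rule measure_pmf.finite_measure_mono, rule subsetI)
    fix X :: "'a \<Rightarrow> nat \<Rightarrow> int"
    let ?K = "{w \<in> sparse m k. \<forall>j\<in>S. even (ip m w (X j))}"
    assume "X \<in> {X. 2 ^ l < card {w \<in> sparse m k. \<forall>j\<in>S. even (ip m w (X j))}}"
    then have c: "2 ^ l < card ?K" by simp
    have "\<exists>f\<in>{..<l} \<rightarrow>\<^sub>E ?K. \<exists>P b. P \<subseteq> {..<m} \<and> card P = l \<and>
     (\<forall>p\<in>P. \<forall>r\<in>P. odd (b p r) \<longleftrightarrow> p = r) \<and>
     (\<forall>x. (\<forall>j<l. even (ip m (f j) x)) \<longrightarrow> (\<forall>p\<in>P. even (ip m (b p) x)))"
      by (rule parity_pivots[OF _ _ c]) (auto simp: sparse_def)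
    then obtain f where f: "f \<in> {..<l} \<rightarrow>\<^sub>E ?K" and ex: "\<exists>P b. P \<subseteq> {..<m} \<and> card P = l \<and>
     (\<forall>p\<in>P. \<forall>r\<in>P. odd (b p r) \<longleftrightarrow> p = r) \<and>
     (\<forall>x. (\<forall>j<l. even (ip m (f j) x)) \<longrightarrow> (\<forall>p\<in>P. even (ip m (b p) x)))" by (elim bexE)
    have "f \<in> \<F>" unfolding \<F>_def using f ex by (intro CollectI conjI) (auto simp: PiE_iff)
    moreover have "X ` S \<subseteq> ?E f" using f by (auto simp: PiE_iff)
    ultimately show "X \<in> (\<Union>f\<in>\<F>. {X. X ` S \<subseteq> ?E f})" by blast
  qed simp
  also have "\<dots> \<le> (\<Sum>f\<in>\<F>. prob ?Q {X. X ` S \<subseteq> ?E f})"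
    using finF by (intro measure_pmf.finite_measure_subadditive_finite) auto
  also have "\<dots> \<le> (\<Sum>f\<in>\<F>. (max q (1 - q) ^ l) ^ card S)"
  proof (rule sum_mono)
    fix f assume "f \<in> \<F>"
    then obtain P b where Pb: "P \<subseteq> {..<m}" "card P = l" "\<forall>p\<in>P. \<forall>r\<in>P. odd (b p r) \<longleftrightarrow> p = r"
     "\<forall>x. (\<forall>j<l. even (ip m (f j) x)) \<longrightarrow> (\<forall>p\<in>P. even (ip m (b p) x))" unfolding \<F>_def by blast
    have "prob (random_vec m (bernoulli_int q)) (?E f) \<le> max q (1 - q) ^ card P"
      by (rule prob_even_le[OF q Pb(1), where b = b]) (use Pb in auto)
    then show "prob ?Q {X. X ` S \<subseteq> ?E f} \<le> (max q (1 - q) ^ l) ^ card S"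
      using S Pb(2) by (simp add: prob_Pi_pmf_all power_mono)
  qed
  also have "\<dots> = card \<F> * (max q (1 - q) ^ l) ^ card S" by simp
  also have "\<dots> \<le> real (card (sparse m k)) ^ l * (max q (1 - q) ^ l) ^ card S"
    using cardF q by (intro mult_right_mono) auto
  finally show ?thesis .
qed

text \<open>Union bound over \<open>J\<close>: given the columns in \<open>J\<close>, each of the at
  least \<open>k\<close> other columns falls into their span with probability at most
  \<open>e\<close>. This settles the case of a span of small probability.\<close>

lemma prob_thin_span_le:
  fixes p :: "(nat \<Rightarrow> int) pmf"
  assumes S: "finite S" and e: "0 \<le> e" "e \<le> 1"
  shows "prob (Pi_pmf S d (\<lambda>_. p))
     {X. \<exists>J\<subseteq>S. card J + k \<le> card S \<and> X ` S \<subseteq> cl m (X ` J) \<and> prob p (cl m (X ` J)) \<le> e} \<le> 2 ^ card S * e ^ k"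
proof -
  let ?Q = "Pi_pmf S d (\<lambda>_. p)"
  let ?\<J> = "{J. J \<subseteq> S \<and> card J + k \<le> card S}"
  let ?E = "\<lambda>J. {X. X ` (S - J) \<subseteq> cl m (X ` J) \<and> prob p (cl m (X ` J)) \<le> e}"
  have fJ: "finite ?\<J>" using S by simp
  have "prob ?Q {X. \<exists>J\<subseteq>S. card J + k \<le> card S \<and> X ` S \<subseteq> cl m (X ` J) \<and> prob p (cl m (X ` J)) \<le> e}
     \<le> prob ?Q (\<Union>J\<in>?\<J>. ?E J)"
    by (intro measure_pmf.finite_measure_mono) auto
  also have "\<dots> \<le> (\<Sum>J\<in>?\<J>. prob ?Q (?E J))"
    using fJ by (intro measure_pmf.finite_measure_subadditive_finite) auto
  also have "\<dots> \<le> (\<Sum>J\<in>?\<J>. e ^ k)"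
  proof (rule sum_mono)
    fix J assume "J \<in> ?\<J>"
    then have J: "J \<subseteq> S" "card J + k \<le> card S" by auto
    have im: "(\<lambda>x. if x \<in> J then f x else g x) ` J = f ` J"
        "(\<lambda>x. if x \<in> J then f x else g x) ` (S - J) = g ` (S - J)" for f g :: "'a \<Rightarrow> nat \<Rightarrow> int"
      by (auto intro: image_cong)
    have "prob ?Q (?E J) \<le> prob ?Q {X. prob p (cl m (X ` J)) \<le> e} * e ^ card (S - J)"
    proof (rule Pi_pmf_factor_le[where T = J])
      fix h :: "'a \<Rightarrow> nat \<Rightarrow> int" assume h: "prob p (cl m (h ` J)) \<le> e"
      have "prob (Pi_pmf (S - J) d (\<lambda>_. p)) {g. (\<lambda>x. if x \<in> J then h x else g x) \<in> ?E J}
         \<le> prob (Pi_pmf (S - J) d (\<lambda>_. p)) {g. g ` (S - J) \<subseteq> cl m (h ` J)}"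
        by (intro measure_pmf.finite_measure_mono) (simp_all add: im Collect_mono)
      also have "\<dots> = prob p (cl m (h ` J)) ^ card (S - J)" using S by (simp add: prob_Pi_pmf_all)
      also have "\<dots> \<le> e ^ card (S - J)" using h by (intro power_mono) auto
      finally show "prob (Pi_pmf (S - J) d (\<lambda>_. p)) {g. (\<lambda>x. if x \<in> J then h x else g x) \<in> ?E J} \<le> e ^ card (S - J)" .
    next
      fix f f' :: "'a \<Rightarrow> nat \<Rightarrow> int" assume "\<And>x. x \<in> J \<Longrightarrow> f x = f' x"
      then have "f ` J = f' ` J" by (intro image_cong) auto
      then show "(prob p (cl m (f ` J)) \<le> e) = (prob p (cl m (f' ` J)) \<le> e)" by simp
    qed (use S J e in auto)
    also have "\<dots> \<le> 1 * e ^ card (S - J)" using e by (intro mult_right_mono) auto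
    also have "\<dots> \<le> e ^ k"
      using J e S by (simp add: card_Diff_subset finite_subset power_decreasing)
    finally show "prob ?Q (?E J) \<le> e ^ k" .
  qed
  also have "\<dots> = card ?\<J> * e ^ k" by simp
  also have "\<dots> \<le> 2 ^ card S * e ^ k"
  proof -
    have "card ?\<J> \<le> card (Pow S)" using S by (intro card_mono) auto
    then have "real (card ?\<J>) \<le> real (2 ^ card S)" using S by (simp add: card_Pow del: of_nat_power)
    then show ?thesis using e by (intro mult_right_mono) auto
  qed
  finally show ?thesis .
qed

text \<open>At most \<open>s\<close> coordinates determine a vector of the closure, and no value of
  a lazy sign has probability above \<open>1 - \<mu>\<close>, as
  \<open>\<mu> \<le> 1/2\<close>.\<close>

lemma prob_lazy_sign_cl_le:
  assumes \<mu>: "0 \<le> \<mu>" "\<mu> \<le> 1/2" and Z: "finite Z" "card Z \<le> s"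
  shows "prob (random_vec m (lazy_sign \<mu>)) (cl m Z) \<le> (1 - \<mu>) ^ (m - s)"
proof -
  obtain T where T: "T \<subseteq> {..<m}" "card T \<le> card Z"
    "\<forall>x\<in>cl m Z. \<forall>y\<in>cl m Z. (\<forall>i\<in>T. x i = y i) \<longrightarrow> (\<forall>i<m. x i = y i)"
    using cl_determined[OF Z(1)] by blast
  have "prob (random_vec m (lazy_sign \<mu>)) (cl m Z) \<le> (1 - \<mu>) ^ (card {..<m} - card T)"
  proof (rule prob_determined_le[OF _ T(1)])
    fix x y i assume "x \<in> cl m Z" "y \<in> cl m Z" "\<And>i. i \<in> T \<Longrightarrow> x i = y i" "i \<in> {..<m}"
    then show "x i = y i" using T(3) by blast
  qed (use \<mu> in \<open>auto simp: pmf_lazy_sign\<close>)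
  also have "\<dots> \<le> (1 - \<mu>) ^ (m - s)" using T Z \<mu> by (intro power_decreasing) auto
  finally show ?thesis .
qed

text \<open>Low rank forces one of three events, which give the three summands in this order: many
  sparse annihilators modulo 2; a span of tiny probability; a span whose probability is at most
  \<open>R\<close> times its lazy sign probability, to which \<open>swap_bound\<close>
  applies.\<close>

lemma prob_low_rank_le:
  fixes q a :: real and S :: "nat set"
  assumes q: "0 < q" "q < 1" and S: "finite S" "card S = m" and l: "l \<le> k"
  defines "\<mu> \<equiv> q * (1 - q) / 4"
  assumes s: "2 * real s * (1 - \<mu>) ^ (m - s) \<le> exp (- 8 * \<mu> * a * m)" and a: "2 * exp (- 8 * \<mu> * a * m) \<le> 1"
  shows "prob (Pi_pmf S d (\<lambda>_. random_vec m (bernoulli_int q))) {X. \<exists>J\<subseteq>S. card J + k \<le> m \<and> X ` S \<subseteq> cl m (X ` J)}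
    \<le> real (card (sparse m (4 * a * m))) ^ l * (max q (1 - q) ^ l) ^ m
      + 2 ^ m * (2 * exp (- 8 * \<mu> * a * m)) ^ k + 2 * 2 ^ m * (2 * 2 ^ l / 2 ^ k) ^ s"
proof -
  let ?p = "random_vec m (bernoulli_int q)" and ?q = "random_vec m (lazy_sign \<mu>)"
  let ?Q = "Pi_pmf S d (\<lambda>_. ?p)"
  define \<epsilon> where "\<epsilon> = exp (- 8 * \<mu> * a * m)"
  define h where "h = (1 - \<mu>) ^ (m - s)"
  define R :: real where "R = 2 * 2 ^ l / 2 ^ k"
  have \<mu>: "0 \<le> \<mu>" "\<mu> \<le> 1/2"
  proof -
    have "q * (1 - q) \<le> 1 / 4" using zero_le_power2[of "q - 1/2"] by (simp add: power2_eq_square algebra_simps)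
    then show "\<mu> \<le> 1/2" by (simp add: \<mu>_def)
    show "0 \<le> \<mu>" using q by (simp add: \<mu>_def)
  qed
  let ?E1 = "{X. 2 ^ l < card {w \<in> sparse m (4 * a * m). \<forall>j\<in>S. even (ip m w (X j))}}"
  let ?E2 = "{X. \<exists>J\<subseteq>S. card J + k \<le> card S \<and> X ` S \<subseteq> cl m (X ` J) \<and> prob ?p (cl m (X ` J)) \<le> 2 * \<epsilon>}"
  let ?E3 = "{X. \<exists>V. cl m (X ` S) = V \<and> prob ?p V \<le> R * prob ?q V \<and> 2 * real s * h \<le> prob ?q V \<and> 0 < prob ?q V}"
  have "{X. \<exists>J\<subseteq>S. card J + k \<le> m \<and> X ` S \<subseteq> cl m (X ` J)} \<subseteq> ?E1 \<union> ?E2 \<union> ?E3"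
  proof
    fix X assume "X \<in> {X. \<exists>J\<subseteq>S. card J + k \<le> m \<and> X ` S \<subseteq> cl m (X ` J)}"
    then obtain J where J: "J \<subseteq> S" "card J + k \<le> m" "X ` S \<subseteq> cl m (X ` J)" by blast
    define V where "V = cl m (X ` J)"
    have VS: "cl m (X ` S) = V" unfolding V_def using J by (intro subset_antisym cl_subset cl_mono image_mono) auto
    show "X \<in> ?E1 \<union> ?E2 \<union> ?E3"
    proof (cases "prob ?p V \<le> 2 * \<epsilon>")
      case True
      then show ?thesis using J S unfolding V_def by blast
    next
      case False
      have fJ: "finite J" using J S finite_subset by blast
      obtain P D b where P: "pivots m (ann m (X ` J)) P D b" "m \<le> card P + card (X ` J)"
        "V = {x. \<forall>r\<in>P. ip m (b r) x = 0}"
        unfolding V_def by (rule annihilator_pivots[OF finite_imageI[OF fJ]])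
      have kP: "k \<le> card P" using P(2) J(2) card_image_le[OF fJ, of X] by linarith
      let ?H = "card {w \<in> sparse m (4 * a * m). \<forall>x\<in>V. even (ip m w x)}"
      have rb: "prob ?p V \<le> \<epsilon> + ?H / 2 ^ card P * prob ?q V"
        using ratio_bound[OF q P(1,3), of a] by (simp add: \<epsilon>_def \<mu>_def)
      show ?thesis
      proof (cases "?H \<le> 2 ^ l")
        case True
        have "real ?H \<le> real (2 ^ l)" using True by (rule of_nat_mono)
        then have "real ?H \<le> 2 ^ l" by simp
        moreover have "(2::real) ^ k \<le> 2 ^ card P" using kP by (intro power_increasing) auto
        ultimately have H: "?H / 2 ^ card P \<le> 2 ^ l / (2::real) ^ k" by (intro frac_le) auto
        have "(2::real) ^ l / 2 ^ k \<le> 1" using l by (simp add: power_increasing)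
        then have H1: "?H / 2 ^ card P \<le> (1::real)" using H by linarith
        \<comment> \<open>As the probability of \<open>V\<close> exceeds
          \<open>2 * \<epsilon>\<close>, the error term of the comparison is less than half of it
          and is absorbed by the factor 2 in \<open>R\<close>. The same inequality yields the lower
          bound on \<open>prob ?q V\<close> that \<open>swap_bound\<close> requires.\<close>
        have "\<epsilon> < ?H / 2 ^ card P * prob ?q V" using rb False by linarith
        also have "\<dots> \<le> 1 * prob ?q V" using H1 by (intro mult_right_mono) auto
        finally have "\<epsilon> < prob ?q V" by simp
        moreover from calculation have "0 < prob ?q V" unfolding \<epsilon>_def using exp_gt_zero less_trans by blast
        moreover from rb False have "prob ?p V \<le> 2 * (?H / 2 ^ card P * prob ?q V)" by linarith
        then have "prob ?p V \<le> 2 * (2 ^ l / 2 ^ k * prob ?q V)"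
          using mult_right_mono[OF H, of "prob ?q V"] by simp
        ultimately have "prob ?p V \<le> R * prob ?q V \<and> 2 * real s * h \<le> prob ?q V \<and> 0 < prob ?q V"
          using s by (simp add: R_def h_def \<epsilon>_def)
        then show ?thesis using VS by blast
      next
        case False
        \<comment> \<open>The columns lie in \<open>V\<close>, so a vector with even products on
          \<open>V\<close> has even products with all columns.\<close>
        have "?H \<le> card {w \<in> sparse m (4 * a * m). \<forall>j\<in>S. even (ip m w (X j))}"
          using VS cl_superset[of "X ` S" m] finite_sparse by (intro card_mono) auto
        then show ?thesis using False by simp
      qed
    qed
  qed
  then have "prob ?Q {X. \<exists>J\<subseteq>S. card J + k \<le> m \<and> X ` S \<subseteq> cl m (X ` J)} \<le> prob ?Q (?E1 \<union> ?E2 \<union> ?E3)"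
    by (intro measure_pmf.finite_measure_mono) auto
  also have "\<dots> \<le> prob ?Q ?E1 + prob ?Q ?E2 + prob ?Q ?E3"
  proof -
    have "prob ?Q (?E1 \<union> ?E2 \<union> ?E3) \<le> prob ?Q (?E1 \<union> ?E2) + prob ?Q ?E3"
      by (intro measure_Un_le) auto
    moreover have "prob ?Q (?E1 \<union> ?E2) \<le> prob ?Q ?E1 + prob ?Q ?E2"
      by (intro measure_Un_le) auto
    ultimately show ?thesis by linarith
  qed
  also have "\<dots> \<le> real (card (sparse m (4 * a * m))) ^ l * (max q (1 - q) ^ l) ^ card S
      + 2 ^ card S * (2 * \<epsilon>) ^ k + 2 * 2 ^ card S * R ^ s"
  proof (intro add_mono)
    show "prob ?Q ?E1 \<le> real (card (sparse m (4 * a * m))) ^ l * (max q (1 - q) ^ l) ^ card S"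
      by (rule prob_many_sparse_le[OF q S(1)])
    show "prob ?Q ?E2 \<le> 2 ^ card S * (2 * \<epsilon>) ^ k"
      using a by (intro prob_thin_span_le S) (auto simp: \<epsilon>_def)
    show "prob ?Q ?E3 \<le> 2 * 2 ^ card S * R ^ s"
    proof (rule swap_bound)
      show "finite (set_pmf ?p)"
        using set_bernoulli_int[of q] by (auto simp: set_Pi_pmf intro!: finite_PiE_dflt finite_subset[OF set_bernoulli_int])
      show "0 \<le> h" using \<mu> by (simp add: h_def)
      show "prob ?q (cl m Z) \<le> h" if "finite Z" "card Z < s" for Z
        unfolding h_def using \<mu> that by (intro prob_lazy_sign_cl_le) auto
    qed (use S in \<open>auto simp: R_def\<close>)
  qed
  finally show ?thesis by (simp add: S \<epsilon>_def R_def)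
qed

text \<open>With \<open>l = k div 2\<close> and \<open>s = m div 2\<close>, each of the three terms
  decays like exp (- c k m) once \<open>k\<close> and \<open>m\<close> exceed constants depending on
  \<open>q\<close>.\<close>

lemma prob_low_rank_le_exp:
  fixes q :: real
  assumes q: "0 < q" "q < 1"
  shows "\<exists>c>0. \<exists>K M :: nat. \<forall>m k. \<forall>S :: nat set. M \<le> m \<longrightarrow> K \<le> k \<longrightarrow> finite S \<longrightarrow> card S = m \<longrightarrow>
       prob (Pi_pmf S (\<lambda>_. 0) (\<lambda>_. random_vec m (bernoulli_int q))) {X. \<exists>J\<subseteq>S. card J + k \<le> m \<and> X ` S \<subseteq> cl m (X ` J)}
       \<le> 3 * exp (- c * k * m)"
proof -
  define r where "r = max q (1 - q)"
  have r: "0 < r" "r < 1" using q by (auto simp: r_def)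
  \<comment> \<open>A parity condition gains exp (-\<gamma>) per column. Allowing at most exp
    (\<gamma> m / 2) sparse vectors leaves half of the exponent after the union bound.\<close>
  define \<gamma> where "\<gamma> = - ln r"
  have \<gamma>: "0 < \<gamma>" "exp (- \<gamma>) = r" using r by (auto simp: \<gamma>_def)
  obtain \<kappa> where \<kappa>: "0 < \<kappa>" "\<kappa> \<le> 1/8" "\<And>m. real (card (sparse m (\<kappa> * m))) \<le> exp (\<gamma> / 2 * m)"
    using card_sparse_le_exp[of "\<gamma> / 2"] \<gamma>(1) by (metis half_gt_zero)
  define a where "a = \<kappa> / 4"
  define \<mu> where "\<mu> = q * (1 - q) / 4"
  have \<mu>: "0 < \<mu>" "\<mu> \<le> 1/16"
  proof -
    have "q * (1 - q) \<le> 1 / 4" using zero_le_power2[of "q - 1/2"] by (simp add: power2_eq_square algebra_simps)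
    then show "\<mu> \<le> 1/16" by (simp add: \<mu>_def)
    show "0 < \<mu>" using q by (simp add: \<mu>_def)
  qed
  define \<beta> where "\<beta> = 8 * \<mu> * a"
  have \<beta>: "0 < \<beta>" "\<beta> \<le> \<mu> / 4"
    using \<mu> \<kappa>(1,2) mult_left_mono[OF \<kappa>(2), of \<mu>] by (auto simp: \<beta>_def a_def)
  \<comment> \<open>One rate for each of the bounds \<open>T1\<close>, \<open>T2\<close> and
    \<open>T3\<close> below.\<close>
  define c where "c = min (\<gamma> / 8) (min (\<beta> / 2) (1 / 64))"
  have c: "0 < c" "c \<le> \<gamma> / 8" "c \<le> \<beta> / 2" "c \<le> 1 / 64" using \<gamma> \<beta> by (auto simp: c_def)
  \<comment> \<open>The value 96 gives \<open>3 * m \<le> k * m / 32\<close>, which absorbs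
    \<open>1 + m + s\<close> in \<open>T3\<close>. The value \<open>4 / \<beta>\<close> gives
    \<open>m + k \<le> \<beta> * m * k / 2\<close> for \<open>T2\<close>, and the last entry of
    \<open>M\<close> gives \<open>m \<le> exp (\<mu> * m / 4)\<close> for \<open>A\<close>.\<close>
  define K where "K = max 96 (nat \<lceil>4 / \<beta>\<rceil>)"
  define M where "M = max 2 (max (nat \<lceil>4 / \<beta>\<rceil>) (nat \<lceil>32 / \<mu>\<^sup>2\<rceil>))"
  have "prob (Pi_pmf S (\<lambda>_. 0) (\<lambda>_. random_vec m (bernoulli_int q))) {X. \<exists>J\<subseteq>S. card J + k \<le> m \<and> X ` S \<subseteq> cl m (X ` J)}
       \<le> 3 * exp (- c * k * m)" if m: "M \<le> m" and k: "K \<le> k" and S: "finite S" "card S = m" for m k and S :: "nat set"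
  proof -
    define l where "l = k div 2"
    define s where "s = m div 2"
    have m2: "2 \<le> m" "4 / \<beta> \<le> m" "32 / \<mu>\<^sup>2 \<le> m" using m by (auto simp: M_def)
    have k2: "96 \<le> k" "4 / \<beta> \<le> k" using k by (auto simp: K_def)
    have l: "real k / 4 \<le> l" "2 * l \<le> k" using k2(1) by (auto simp: l_def)
    have s: "real m / 4 \<le> s" "2 * s \<le> m" using m2(1) by (auto simp: s_def)
    have mk: "m \<le> \<beta> * m * k / 4" "k \<le> \<beta> * m * k / 4"
    proof -
      have "4 \<le> \<beta> * k" "4 \<le> \<beta> * m" using k2(2) m2(2) \<beta>(1) by (simp_all add: field_simps)
      then show "m \<le> \<beta> * m * k / 4" "k \<le> \<beta> * m * k / 4"
        using mult_right_mono[of 4 "\<beta> * k" "real m"] mult_right_mono[of 4 "\<beta> * m" "real k"]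
        by (simp_all add: algebra_simps)
    qed
    have e: "exp (- 8 * \<mu> * a * m) = exp (- (\<beta> * m))" by (simp add: \<beta>_def)
    have A: "2 * real s * (1 - \<mu>) ^ (m - s) \<le> exp (- 8 * \<mu> * a * m)"
    proof -
      have "(1 - \<mu>) ^ (m - s) \<le> exp (- \<mu>) ^ (m - s)"
        using \<mu> exp_ge_add_one_self[of "- \<mu>"] by (intro power_mono) auto
      also have "\<dots> = exp (- (\<mu> * (m - s)))" by (simp flip: exp_of_nat_mult add: mult.commute)
      also have "\<dots> \<le> exp (- (\<mu> * (m / 2)))"
      proof -
        have "real m / 2 \<le> real (m - s)" using s(2) by linarith
        then show ?thesis using \<mu> by simp
      qed
      finally have "2 * real s * (1 - \<mu>) ^ (m - s) \<le> m * exp (- (\<mu> * (m / 2)))"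
        using s(2) \<mu> by (intro mult_mono) auto
      also have "\<dots> \<le> exp (\<mu> * m / 4) * exp (- (\<mu> * (m / 2)))"
      proof (rule mult_right_mono)
        have "32 \<le> \<mu>\<^sup>2 * m" using m2(3) \<mu> by (simp add: field_simps)
        then have "real m * 32 \<le> real m * (\<mu>\<^sup>2 * m)" by (intro mult_left_mono) auto
        then have "m \<le> (\<mu> * m / 4)\<^sup>2 / 2" by (simp add: power2_eq_square field_simps)
        also have "(\<mu> * m / 4)\<^sup>2 / 2 \<le> exp (\<mu> * m / 4)"
        proof -
          have "0 \<le> \<mu> * m / 4" using \<mu> by simp
          then show ?thesis using exp_lower_Taylor_quadratic[of "\<mu> * m / 4"] by linarith
        qed
        finally show "real m \<le> exp (\<mu> * m / 4)" .
      qed simp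
      also have "\<dots> = exp (- (\<mu> / 4 * m))" by (simp flip: exp_add add: algebra_simps)
      also have "\<dots> \<le> exp (- (\<beta> * m))" using mult_right_mono[OF \<beta>(2), of "real m"] by simp
      finally show ?thesis unfolding e .
    qed
    have e1: "2 \<le> exp (1::real)" using exp_ge_add_one_self[of "1::real"] by simp
    have B: "2 * exp (- 8 * \<mu> * a * m) \<le> 1"
    proof -
      have "4 \<le> \<beta> * m" using m2(2) \<beta>(1) by (simp add: field_simps)
      then have "2 * exp (- (\<beta> * m)) \<le> exp 1 * exp (- 1)" using e1 by (intro mult_mono) auto
      then show ?thesis unfolding e by (simp flip: exp_add)
    qed
    have T1: "real (card (sparse m (4 * a * m))) ^ l * (r ^ l) ^ m \<le> exp (- c * k * m)"
    proof -
      have "real (card (sparse m (4 * a * m))) ^ l * (r ^ l) ^ m \<le> exp (\<gamma> / 2 * m) ^ l * (exp (- \<gamma>) ^ l) ^ m"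
        using \<kappa>(3)[of m] by (intro mult_mono power_mono) (auto simp: a_def \<gamma>(2) r(1) less_imp_le)
      also have "\<dots> = exp (- (\<gamma> / 2 * (l * m)))"
        by (simp flip: exp_of_nat_mult exp_add add: algebra_simps)
      also have "\<dots> \<le> exp (- (c * k * m))"
      proof -
        have "c * k \<le> \<gamma> / 2 * l"
          using mult_mono[OF c(2), of "k" "4 * real l"] l(1) \<gamma> by simp
        then have "c * k * m \<le> \<gamma> / 2 * l * m" by (intro mult_right_mono) auto
        then show ?thesis by (simp add: mult.assoc)
      qed
      finally show ?thesis by simp
    qed
    have T2: "2 ^ m * (2 * exp (- 8 * \<mu> * a * m)) ^ k \<le> exp (- c * k * m)"
    proof -
      have "2 ^ m * (2 * exp (- 8 * \<mu> * a * m)) ^ k \<le> exp 1 ^ m * (exp 1 * exp (- (\<beta> * m))) ^ k"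
        unfolding e using e1 by (intro mult_mono power_mono) auto
      also have "\<dots> = exp (m + k - \<beta> * m * k)"
        by (simp flip: exp_of_nat_mult exp_add add: algebra_simps)
      also have "\<dots> \<le> exp (- (\<beta> / 2 * k * m))" using mk by (simp add: algebra_simps)
      also have "\<dots> \<le> exp (- (c * k * m))"
        using mult_right_mono[OF c(3), of "real k * m"] by (simp add: mult.assoc)
      finally show ?thesis by simp
    qed
    have T3: "2 * 2 ^ m * (2 * 2 ^ l / 2 ^ k) ^ s \<le> exp (- c * k * m)"
    proof -
      \<comment> \<open>Because \<open>2 * l \<le> k\<close>, the base of the power \<open>s\<close>
        is at most 2^(1 - l). The gain 2^(-l s) with l s \<ge> k m / 16 outweighs the factors 2^(1 +
        m + s).\<close>
      have "(2::real) ^ (l + l) \<le> 2 ^ k" using l(2) by (intro power_increasing) auto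
      then have "2 * 2 ^ l / 2 ^ k \<le> 2 * 2 ^ l / (2::real) ^ (l + l)" by (intro divide_left_mono) auto
      also have "\<dots> = 2 * inverse 2 ^ l" by (simp add: power_add power_inverse field_simps)
      finally have "2 * 2 ^ m * (2 * 2 ^ l / 2 ^ k) ^ s \<le> 2 * 2 ^ m * (2 * inverse 2 ^ l :: real) ^ s"
        by (intro mult_left_mono power_mono) auto
      also have "\<dots> = 2 powr (1 + m + s - real l * s)"
      proof -
        have "(inverse 2 ^ l :: real) = 2 powr (- real l)" by (simp add: powr_minus powr_realpow power_one_over inverse_eq_divide)
        then have "2 * inverse 2 ^ l = (2::real) powr (1 + - real l)"
          by (subst powr_add) simp
        then have "(2 * inverse 2 ^ l :: real) ^ s = 2 powr (s * (1 + - real l))"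
          using powr_power[of "2::real" "1 + - real l" s] by simp
        moreover have "2 * 2 ^ m = (2::real) powr (1 + m)" by (simp add: powr_add powr_realpow)
        ultimately show ?thesis by (simp only: powr_add[symmetric]) (simp add: algebra_simps)
      qed
      also have "\<dots> \<le> 2 powr (- (k * m / 32))"
      proof (rule powr_mono)
        define P where "P = real k * real m"
        have "k / 4 * (m / 4) \<le> real l * s" using l s by (intro mult_mono) auto
        then have "P / 16 \<le> real l * s" by (simp add: P_def)
        moreover have "96 * real m \<le> P" unfolding P_def using k2(1) by (intro mult_right_mono) auto
        moreover have "real (k * m) = P" by (simp add: P_def)
        ultimately show "1 + m + s - real l * s \<le> - (k * m / 32)" using s(2) m2(1) by linarith
      qed simp
      also have "\<dots> = exp (- (ln 2 * (k * m / 32)))" by (simp add: powr_def)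
      also have "\<dots> \<le> exp (- (1 / 2 * (k * m / 32)))"
      proof -
        have "(1::real) / 2 \<le> ln 2" using ln2_ge_two_thirds by simp
        then have "1 / 2 * (real (k * m) / 32) \<le> ln 2 * (real (k * m) / 32)" by (intro mult_right_mono) auto
        then show ?thesis by simp
      qed
      also have "\<dots> \<le> exp (- (c * k * m))"
        using mult_right_mono[OF c(4), of "real k * m"] by (simp add: mult.assoc)
      finally show ?thesis by simp
    qed
    have "l \<le> k" by (simp add: l_def)
    from prob_low_rank_le[OF q S this A[unfolded \<mu>_def] B[unfolded \<mu>_def], of "\<lambda>_. 0"]
    show ?thesis using T1 T2 T3 by (simp add: \<mu>_def r_def)
  qed
  then show ?thesis using c(1)
    by (intro exI[of _ c] exI[of _ K] exI[of _ M] conjI allI impI)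
qed

section \<open>The random matrix as a family of independent columns\<close>

lemma Pi_pmf_curry:
  fixes p :: "'a \<times> 'b \<Rightarrow> 'c pmf"
  assumes fin: "finite A" "finite B"
  shows "map_pmf (\<lambda>h j i. h (i, j)) (Pi_pmf (A \<times> B) d p) = Pi_pmf B (\<lambda>_. d) (\<lambda>j. Pi_pmf A d (\<lambda>i. p (i, j)))"
proof (rule pmf_eqI)
  fix g :: "'b \<Rightarrow> 'a \<Rightarrow> 'c"
  let ?F = "\<lambda>(h :: 'a \<times> 'b \<Rightarrow> 'c) j i. h (i, j)"
  define h where "h = (\<lambda>(i, j). g j i)"
  have g: "g = ?F h" by (simp add: h_def)
  have inj: "inj ?F" by (rule injI) (auto simp: fun_eq_iff)
  have L: "pmf (map_pmf ?F (Pi_pmf (A \<times> B) d p)) g = pmf (Pi_pmf (A \<times> B) d p) h"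
    unfolding g using inj by (rule pmf_map_inj')
  show "pmf (map_pmf ?F (Pi_pmf (A \<times> B) d p)) g = pmf (Pi_pmf B (\<lambda>_. d) (\<lambda>j. Pi_pmf A d (\<lambda>i. p (i, j)))) g"
  proof (cases "\<forall>j i. (i, j) \<notin> A \<times> B \<longrightarrow> g j i = d")
    case True
    have "pmf (Pi_pmf (A \<times> B) d p) h = (\<Prod>(i, j)\<in>A \<times> B. pmf (p (i, j)) (g j i))"
    proof (subst pmf_Pi')
      show "h x = d" if "x \<notin> A \<times> B" for x using True that by (cases x) (simp add: h_def)
    qed (use fin in \<open>auto simp: h_def case_prod_unfold\<close>)
    also have "\<dots> = (\<Prod>j\<in>B. \<Prod>i\<in>A. pmf (p (i, j)) (g j i))"
      by (simp add: prod.cartesian_product[symmetric] prod.swap[of _ A])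
    also have "\<dots> = (\<Prod>j\<in>B. pmf (Pi_pmf A d (\<lambda>i. p (i, j))) (g j))"
      using fin True by (intro prod.cong refl pmf_Pi'[symmetric]) auto
    also have "\<dots> = pmf (Pi_pmf B (\<lambda>_. d) (\<lambda>j. Pi_pmf A d (\<lambda>i. p (i, j)))) g"
      using fin True by (intro pmf_Pi'[symmetric]) auto
    finally show ?thesis using L by simp
  next
    case False
    then obtain i j where ij: "(i, j) \<notin> A \<times> B" "g j i \<noteq> d" by blast
    have "pmf (Pi_pmf (A \<times> B) d p) h = 0"
      using fin ij by (intro pmf_Pi_outside) (auto simp: h_def)
    moreover have "pmf (Pi_pmf B (\<lambda>_. d) (\<lambda>j. Pi_pmf A d (\<lambda>i. p (i, j)))) g = 0"
    proof (cases "j \<in> B")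
      case True
      then have "pmf (Pi_pmf A d (\<lambda>i. p (i, j))) (g j) = 0"
        using fin ij by (intro pmf_Pi_outside) auto
      then show ?thesis using fin True by (subst pmf_Pi) auto
    next
      case False
      then show ?thesis using fin ij by (intro pmf_Pi_outside) auto
    qed
    ultimately show ?thesis using L by simp
  qed
qed

lemma prob_Pi_pmf_local:
  assumes "finite A" "S \<subseteq> A" "\<And>h h'. (\<And>x. x \<in> S \<Longrightarrow> h x = h' x) \<Longrightarrow> F h = F h'"
  shows "prob (Pi_pmf A d p) {h. F h} = prob (Pi_pmf S d p) {h. F h}"
proof -
  have "prob (Pi_pmf S d p) {h. F h} = prob (Pi_pmf A d p) {h. F (\<lambda>x. if x \<in> S then h x else d)}"
    by (simp add: Pi_pmf_subset[OF assms(1,2)] vimage_def)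
  moreover have "F (\<lambda>x. if x \<in> S then h x else d) = F h" for h by (rule assms(3)) simp
  ultimately show ?thesis by simp
qed

lemma card_subsets_le: "card {S. S \<subseteq> {..<n} \<and> card S = m} \<le> n ^ m"
proof (cases "m \<le> n")
  case True
  then show ?thesis using n_subsets[of "{..<n}" m] binomial_le_pow[of m n] by simp
next
  case False
  have "card S \<le> n" if "S \<subseteq> {..<n}" for S using card_mono[OF _ that] by simp
  then have "{S. S \<subseteq> {..<n} \<and> card S = m} = {}" using False by auto
  then show ?thesis by (simp only: card.empty)
qed

section \<open>Blocks of zeros among many columns\<close>

lemma prob_zero_block_ge:
  assumes q: "0 < q" "q < 1" and lm: "l \<le> m" and mn: "m \<le> n"
  shows "1 - n ^ m * (1 - (1 - q) ^ l) ^ (n - m)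
    \<le> prob (Pi_pmf {..<n} (\<lambda>_. 0) (\<lambda>_. random_vec m (bernoulli_int q))) {x. \<exists>S\<subseteq>{..<n}. card S = m \<and> (\<forall>j\<in>S. \<forall>i<l. x j i = 0)}"
proof -
  let ?Q = "Pi_pmf {..<n} (\<lambda>_. 0) (\<lambda>_. random_vec m (bernoulli_int q))"
  let ?Z = "{v :: nat \<Rightarrow> int. \<forall>i<l. v i = 0}"
  let ?E = "{x. \<exists>S\<subseteq>{..<n}. card S = m \<and> (\<forall>j\<in>S. \<forall>i<l. x j i = 0)}"
  let ?W = "{W. W \<subseteq> {..<n} \<and> card W = m}"
  have pZ: "prob (random_vec m (bernoulli_int q)) ?Z = (1 - q) ^ l"
  proof -
    have "?Z = Pi {..<l} (\<lambda>_. {0})" by auto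
    then have "?Z = Pi {..<m} (\<lambda>i. if i < l then {0} else UNIV)" using lm by (auto simp: Pi_iff split: if_splits)
    then have "prob (random_vec m (bernoulli_int q)) ?Z = (\<Prod>i<m. prob (bernoulli_int q) (if i < l then {0} else UNIV))"
      by (simp add: measure_Pi_pmf_Pi)
    also have "\<dots> = (\<Prod>i<l. prob (bernoulli_int q) {0})"
      using lm by (intro prod.mono_neutral_cong_right) auto
    finally show ?thesis using q by (simp add: measure_pmf_single pmf_bernoulli_int)
  qed
  \<comment> \<open>If fewer than \<open>m\<close> columns vanish on the first \<open>l\<close>
    rows, they all fit into some \<open>W\<close> of size exactly \<open>m\<close>, and none of the
    remaining \<open>n - m\<close> columns vanishes there.\<close>
  have "- ?E \<subseteq> (\<Union>W\<in>?W. {x. x ` ({..<n} - W) \<subseteq> - ?Z})"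
  proof
    fix x :: "nat \<Rightarrow> nat \<Rightarrow> int" assume x: "x \<in> - ?E"
    let ?T = "{j \<in> {..<n}. x j \<in> ?Z}"
    have "card ?T < m"
    proof (rule ccontr)
      assume "\<not> card ?T < m"
      then obtain S where "S \<subseteq> ?T" "card S = m" by (meson not_less obtain_subset_with_card_n)
      then show False using x by auto
    qed
    then obtain W where W: "?T \<subseteq> W" "W \<subseteq> {..<n}" "card W = m"
      using exists_subset_between[of ?T m "{..<n}"] mn by auto
    then show "x \<in> (\<Union>W\<in>?W. {x. x ` ({..<n} - W) \<subseteq> - ?Z})" by auto
  qed
  then have "prob ?Q (- ?E) \<le> prob ?Q (\<Union>W\<in>?W. {x. x ` ({..<n} - W) \<subseteq> - ?Z})"
    by (intro measure_pmf.finite_measure_mono) auto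
  also have "\<dots> \<le> (\<Sum>W\<in>?W. prob ?Q {x. x ` ({..<n} - W) \<subseteq> - ?Z})"
    by (intro measure_pmf.finite_measure_subadditive_finite) auto
  also have "\<dots> = (\<Sum>W\<in>?W. (1 - (1 - q) ^ l) ^ (n - m))"
  proof (rule sum.cong[OF refl])
    fix W assume "W \<in> ?W"
    then have W: "W \<subseteq> {..<n}" "card W = m" by auto
    have "prob ?Q {x. x ` ({..<n} - W) \<subseteq> - ?Z}
        = prob (Pi_pmf ({..<n} - W) (\<lambda>_. 0) (\<lambda>_. random_vec m (bernoulli_int q))) {x. x ` ({..<n} - W) \<subseteq> - ?Z}"
    proof (rule prob_Pi_pmf_local)
      fix h h' :: "nat \<Rightarrow> nat \<Rightarrow> int" assume "\<And>x. x \<in> {..<n} - W \<Longrightarrow> h x = h' x"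
      then have "h ` ({..<n} - W) = h' ` ({..<n} - W)" by (intro image_cong) auto
      then show "(h ` ({..<n} - W) \<subseteq> - ?Z) = (h' ` ({..<n} - W) \<subseteq> - ?Z)" by simp
    qed auto
    also have "\<dots> = prob (random_vec m (bernoulli_int q)) (- ?Z) ^ card ({..<n} - W)"
      by (simp add: prob_Pi_pmf_all)
    also have "prob (random_vec m (bernoulli_int q)) (- ?Z) = 1 - (1 - q) ^ l"
      unfolding pZ[symmetric] using measure_pmf.prob_compl[of ?Z "random_vec m (bernoulli_int q)"]
      by (simp add: Compl_eq_Diff_UNIV)
    also have "card ({..<n} - W) = n - m" using W by (simp add: card_Diff_subset finite_subset)
    finally show "prob ?Q {x. x ` ({..<n} - W) \<subseteq> - ?Z} = (1 - (1 - q) ^ l) ^ (n - m)" .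
  qed
  also have "\<dots> = card ?W * (1 - (1 - q) ^ l) ^ (n - m)" by simp
  also have "\<dots> \<le> real (n ^ m) * (1 - (1 - q) ^ l) ^ (n - m)"
  proof (rule mult_right_mono)
    show "real (card ?W) \<le> real (n ^ m)" using card_subsets_le by (rule of_nat_mono)
    have "(1 - q) ^ l \<le> 1" using q by (intro power_le_one) auto
    then show "0 \<le> (1 - (1 - q) ^ l) ^ (n - m)" by simp
  qed
  finally have "prob ?Q (- ?E) \<le> real (n ^ m) * (1 - (1 - q) ^ l) ^ (n - m)" .
  moreover have "prob ?Q (- ?E) = 1 - prob ?Q ?E"
    using measure_pmf.prob_compl[of ?E ?Q] by (simp add: Compl_eq_Diff_UNIV)
  ultimately show ?thesis by simp
qed

text \<open>The constant \<open>c\<close> gives (1 - q)^l \<ge> (1 - q) n^(-1/4), where the factor 1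
  - q pays for rounding \<open>l\<close> up. As n - m \<ge> n / 2, the exponent gained is at least
  (1 - q) n^(3/4) / 2, which beats m (ln n + 1) because m \<le> n^(1/2).\<close>

lemma zero_block_failure_le:
  fixes q c :: real
  assumes q: "0 < q" "q < 1" and c: "c = 1 / (4 * - ln (1 - q))"
    and n: "m\<^sup>2 \<le> n" "2 \<le> m" "128 / (1 - q) \<le> ln n"
    and l: "real l \<le> c * ln n + 1"
  shows "n ^ m * (1 - (1 - q) ^ l) ^ (n - m) \<le> exp (- real m)"
proof -
  define L where "L = ln (real n)"
  have n0: "0 < n" using n(1,2) by (cases n) auto
  have eL: "exp L = n" using n0 by (simp add: L_def)
  define p where "p = (1 - q) ^ l"
  have p01: "0 \<le> p" "p \<le> 1" using q by (auto simp: p_def power_le_one)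
  have lq: "ln (1 - q) < 0" using q by simp
  have p: "(1 - q) * exp (- (L / 4)) \<le> p"
  proof -
    have "ln (1 - q) * (c * L + 1) \<le> ln (1 - q) * l" using l lq by (simp add: L_def)
    moreover have "ln (1 - q) * (c * L + 1) = ln (1 - q) + - (L / 4)" using lq by (simp add: c field_simps)
    ultimately have "exp (ln (1 - q) + - (L / 4)) \<le> exp (ln (1 - q) * l)" by simp
    moreover have "exp (ln (1 - q) + - (L / 4)) = (1 - q) * exp (- (L / 4))"
      using q by (subst exp_add) simp
    moreover have "exp (ln (1 - q) * l) = p" using q by (simp add: p_def exp_of_nat2_mult)
    ultimately show ?thesis by simp
  qed
  have mm: "2 * m \<le> m\<^sup>2" using n(2) by (simp add: power2_eq_square)
  have nm: "real n / 2 \<le> real (n - m)" using mm n(1) by linarith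
  have mL: "real m \<le> exp (L / 2)"
  proof -
    have "(real m)\<^sup>2 \<le> (exp (L / 2))\<^sup>2"
      using n(1) by (simp add: eL flip: exp_double)
    then show ?thesis by (rule power2_le_imp_le) simp
  qed
  have L: "128 / (1 - q) \<le> L" "128 \<le> L"
  proof -
    show "128 / (1 - q) \<le> L" using n(3) by (simp add: L_def)
    moreover have "128 / 1 \<le> 128 / (1 - q)" using q by (intro divide_left_mono) auto
    ultimately show "128 \<le> L" by simp
  qed
  \<comment> \<open>By exp y \<ge> y^2 / 2 at y = L / 4, the right side is at least (1 - q) L^2 /
    64, and \<open>128 \<le> (1 - q) * L\<close> makes this at least 2 L.\<close>
  have "L + 1 \<le> (1 - q) / 2 * exp (L / 4)"
  proof -
    have "128 \<le> (1 - q) * L" using L(1) q by (simp add: field_simps)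
    then have "L * 128 \<le> L * ((1 - q) * L)" using L(2) by (intro mult_left_mono) auto
    then have "L + 1 \<le> (1 - q) / 2 * ((L / 4)\<^sup>2 / 2)" using L(2) by (simp add: power2_eq_square field_simps)
    also have "(L / 4)\<^sup>2 / 2 \<le> exp (L / 4)"
      using exp_lower_Taylor_quadratic[of "L / 4"] L(2) by simp
    finally show ?thesis using q by (simp add: mult_left_mono)
  qed
  then have "m * (L + 1) \<le> exp (L / 2) * ((1 - q) / 2 * exp (L / 4))"
    using mL L(2) by (intro mult_mono) auto
  also have "\<dots> = (1 - q) * exp (- (L / 4)) * (n / 2)"
    by (simp flip: eL exp_add add: mult.assoc[symmetric])
  also have "\<dots> \<le> p * real (n - m)" using p nm p01 by (intro mult_mono) auto
  finally have main: "m * (L + 1) \<le> p * real (n - m)" .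
  have "n ^ m * (1 - p) ^ (n - m) \<le> exp L ^ m * exp (- p) ^ (n - m)"
    using exp_ge_add_one_self[of "- p"] p01 by (intro mult_mono power_mono) (auto simp: eL)
  also have "\<dots> = exp (m * L - p * real (n - m))"
    by (simp flip: exp_of_nat_mult exp_add add: algebra_simps)
  also have "\<dots> \<le> exp (- real m)" using main by (simp add: algebra_simps)
  finally show ?thesis by (simp add: p_def)
qed

section \<open>Ranks of column submatrices\<close>

lemma column_submatrix_eq:
  assumes A: "A \<in> carrier_mat m n" and S: "S \<subseteq> {..<n}"
  shows "column_submatrix A S = mat m (card S) (\<lambda>(i, t). A $$ (i, pick S t))"
proof -
  have "pick {..<m} i = i" if "i < m" for i
  proof -
    have "{a \<in> {..<m}. a < i} = {..<i}" using that by auto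
    then show ?thesis using pick_card_in_set[of i "{..<m}"] that by simp
  qed
  moreover have "{i. i < m \<and> i \<in> {..<m}} = {..<m}" "{j. j < n \<and> j \<in> S} = S" using S by auto
  ultimately show ?thesis using A
    unfolding column_submatrix_def submatrix_def by (intro eq_matI) auto
qed

lemma set_cols_column_submatrix:
  assumes A: "A \<in> carrier_mat m n" and S: "S \<subseteq> {..<n}"
  shows "set (cols (column_submatrix A S)) = (\<lambda>j. vec m (\<lambda>i. A $$ (i, j))) ` S"
proof -
  have fS: "finite S" using S finite_subset by blast
  have "pick S ` {..<card S} = S"
  proof (intro subset_antisym subsetI)
    fix j assume j: "j \<in> S"
    then have "{a \<in> S. a < j} \<subset> S" by auto
    then have "card {a \<in> S. a < j} < card S" using fS by (simp add: psubset_card_mono)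
    then show "j \<in> pick S ` {..<card S}" 
      using pick_card_in_set[OF j] by (intro image_eqI[where x = "card {a \<in> S. a < j}"]) auto
  next
    fix j assume "j \<in> pick S ` {..<card S}"
    then show "j \<in> S" using pick_in_set_le by auto
  qed
  moreover have "set (cols (column_submatrix A S)) = (\<lambda>t. vec m (\<lambda>i. A $$ (i, pick S t))) ` {..<card S}"
  proof -
    let ?B = "column_submatrix A S"
    have "col ?B t = vec m (\<lambda>i. A $$ (i, pick S t))" if "t < card S" for t
      using that by (intro eq_vecI) (auto simp: column_submatrix_eq[OF A S])
    then have "col ?B ` {..<card S} = (\<lambda>t. vec m (\<lambda>i. A $$ (i, pick S t))) ` {..<card S}"
      by (intro image_cong) auto
    moreover have "set (cols ?B) = col ?B ` {..<card S}"
      by (simp add: cols_def column_submatrix_eq[OF A S] lessThan_atLeast0)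
    ultimately show ?thesis by simp
  qed
  moreover have "(\<lambda>t. vec m (\<lambda>i. A $$ (i, pick S t))) ` {..<card S} = (\<lambda>j. vec m (\<lambda>i. A $$ (i, j))) ` (pick S ` {..<card S})"
    by (simp add: image_image)
  ultimately show ?thesis by simp
qed

text \<open>A maximal independent set of columns has as many elements as the rank. An integer vector
  annihilating it annihilates all real combinations, in particular every column; so the real rank
  bounds the number of columns needed to generate the closure.\<close>

lemma span_basis_of_low_rank:
  fixes x :: "nat \<Rightarrow> nat \<Rightarrow> int"
  assumes S: "S \<subseteq> {..<n}" "card S = m"
    and rank: "vec_space.rank m (column_submatrix (mat m n (\<lambda>(i, j). real_of_int (x j i))) S) + k \<le> m"
  shows "\<exists>J\<subseteq>S. card J + k \<le> m \<and> x ` S \<subseteq> cl m (x ` J)"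
proof -
  interpret vec_space "TYPE(real)" m .
  let ?B = "column_submatrix (mat m n (\<lambda>(i, j). real_of_int (x j i))) S"
  define c where "c j = vec m (\<lambda>i. real_of_int (x j i))" for j
  have B: "?B \<in> carrier_mat m (card S)"
    by (subst column_submatrix_eq[OF _ S(1)]) auto
  have colsB: "set (cols ?B) = c ` S"
    by (subst set_cols_column_submatrix[OF mat_carrier S(1)])
       (use S(1) in \<open>auto simp: c_def image_iff intro!: image_cong eq_vecI bexI\<close>)
  have car: "c ` S \<subseteq> carrier_vec m" by (auto simp: c_def)
  obtain U where U: "maximal U (\<lambda>T. T \<subseteq> c ` S \<and> lin_indpt T)"
    using maximal_exists_superset[of "c ` S" "\<lambda>T. T \<subseteq> c ` S \<and> lin_indpt T" "{}"]
      colsB finite_lin_indpt2 by (metis List.finite_set empty_subsetI finite_lin_indpt2 empty_iff finite.emptyI)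
  have UU: "U \<subseteq> c ` S" "lin_indpt U" using U by (auto simp: maximal_def)
  obtain J where J: "J \<subseteq> S" "inj_on c J" "U = c ` J" using UU(1) by (auto simp: subset_image_inj)
  have "card U = rank ?B" using rank_card_indpt[OF B, of U] U colsB by simp
  then have cJ: "card J + k \<le> m" using rank J card_image by metis
  have fU: "finite U" using UU(1) colsB by (metis List.finite_set finite_subset)
  have Uc: "U \<subseteq> carrier_vec m" using UU(1) car by blast
  have ipc: "real_of_int (ip m u (x j)) = (\<Sum>i<m. u i * c j $ i)" for u j
    by (simp add: ip_def c_def)
  have "x j \<in> cl m (x ` J)" if j: "j \<in> S" for j
    unfolding cl_def
  proof safe
    fix u assume "u \<in> ann m (x ` J)"
    then have u: "(\<Sum>i<m. u i * v $ i) = 0" if "v \<in> U" for v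
      using that ipc J(3) by (auto simp: ann_def simp flip: ipc)
    have "c j \<in> span U"
    proof (cases "c j \<in> U")
      case True
      then show ?thesis using Uc span_mem by blast
    next
      case False
      have "\<not> lin_indpt (U \<union> {c j})"
        using U False j UU(1) unfolding maximal_def by blast
      then show ?thesis using lin_dep_iff_in_span[of U "c j"] Uc UU(2) False j car by auto
    qed
    then obtain a where a: "lincomb a U = c j" using finite_in_span[OF fU] Uc by auto
    have "real_of_int (ip m u (x j)) = (\<Sum>i<m. u i * (\<Sum>v\<in>U. a v * v $ i))"
      unfolding ipc a[symmetric] using Uc by (intro sum.cong refl) (simp add: lincomb_index)
    also have "\<dots> = (\<Sum>i<m. \<Sum>v\<in>U. a v * (u i * v $ i))"
      by (simp add: sum_distrib_left mult.left_commute)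
    also have "\<dots> = (\<Sum>v\<in>U. a v * (\<Sum>i<m. u i * v $ i))"
      by (subst sum.swap) (simp add: sum_distrib_left)
    also have "\<dots> = 0" using u by simp
    finally show "ip m u (x j) = 0" by simp
  qed
  then show ?thesis using J(1) cJ by blast
qed

text \<open>The rows in \<open>R\<close> are split off one at a time; a matrix with a single nonzero
  row has rank at most 1, and the rank is subadditive.\<close>

lemma (in vec_space) rank_le_card_rows:
  assumes "finite R" "B \<in> carrier_mat n nc"
    "\<And>i j. i < n \<Longrightarrow> j < nc \<Longrightarrow> i \<notin> R \<Longrightarrow> B $$ (i, j) = 0"
  shows "rank B \<le> card R"
  using assms
proof (induction R arbitrary: B rule: finite_induct)
  case empty
  then have "B = 0\<^sub>m n nc" by (intro eq_matI) auto
  then show ?case by (simp add: rank_0I)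
next
  case (insert r R)
  let ?B1 = "mat n nc (\<lambda>(i, j). if i = r then 0 else B $$ (i, j))"
  let ?B2 = "mat n nc (\<lambda>(i, j). if i = r then B $$ (i, j) else 0)"
  have "B = ?B1 + ?B2" using insert.prems(1) by (intro eq_matI) auto
  then have "rank B \<le> rank ?B1 + rank ?B2" using rank_subadditive[of ?B1 nc ?B2] by simp
  moreover have "rank ?B1 \<le> card R" using insert.prems by (intro insert.IH) auto
  moreover have "rank ?B2 \<le> 1"
    by (rule rank_le_1_product_entries[of _ nc "\<lambda>i. if i = r then 1 else 0" "\<lambda>j. B $$ (r, j)"]) auto
  ultimately show ?case using insert.hyps by simp
qed

lemma bernoulli_mat_columns:
  "bernoulli_mat q m n = map_pmf (\<lambda>x. mat m n (\<lambda>(i, j). real_of_int (x j i)))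
     (Pi_pmf {..<n} (\<lambda>_. 0) (\<lambda>_. random_vec m (bernoulli_int q)))"
proof -
  let ?I = "{..<m} \<times> {..<n}"
  have "Pi_pmf {..<n} (\<lambda>_. 0) (\<lambda>_. random_vec m (bernoulli_int q)) = map_pmf (\<lambda>h j i. h (i, j)) (Pi_pmf ?I 0 (\<lambda>_. bernoulli_int q))"
    by (simp add: Pi_pmf_curry)
  also have "Pi_pmf ?I 0 (\<lambda>_. bernoulli_int q) = map_pmf (\<lambda>h. of_bool \<circ> h) (Pi_pmf ?I False (\<lambda>_. bernoulli_pmf q))"
    unfolding bernoulli_int_def by (rule Pi_pmf_map) auto
  finally show ?thesis
    unfolding bernoulli_mat_def by (simp add: map_pmf_comp o_def case_prod_unfold)
qed

lemma rank_zero_block_le: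
  assumes S: "S \<subseteq> {..<n}" and l: "l \<le> m" and zero: "\<And>j i. j \<in> S \<Longrightarrow> i < l \<Longrightarrow> x j i = 0"
  shows "vec_space.rank m (column_submatrix (mat m n (\<lambda>(i, j). real_of_int (x j i))) S) \<le> m - l"
proof -
  let ?B = "column_submatrix (mat m n (\<lambda>(i, j). real_of_int (x j i))) S"
  have B: "?B = mat m (card S) (\<lambda>(i, t). mat m n (\<lambda>(i, j). real_of_int (x j i)) $$ (i, pick S t))"
    by (rule column_submatrix_eq[OF _ S]) simp
  have "vec_space.rank m ?B \<le> card {l..<m}"
  proof (rule vec_space.rank_le_card_rows)
    show "?B \<in> carrier_mat m (card S)" by (simp add: B)
    fix i t assume *: "i < m" "t < card S" "i \<notin> {l..<m}"
    have "pick S t \<in> S" using *(2) by (intro pick_in_set_le)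
    then show "?B $$ (i, t) = 0" using * S zero by (auto simp: B subset_iff)
  qed simp
  then show ?thesis by simp
qed

section \<open>Both rank estimates for the random matrix\<close>

theorem lemma6p2:
  fixes q :: real
  assumes "0 < q" and "q < 1"
  shows "\<exists>C' C c0 c :: real. 0 < C' \<and> c0 < C \<and> 0 < c0 \<and> 0 < c \<and>
    (\<forall>m n :: nat. 1 \<le> m \<longrightarrow> m \<le> n \<longrightarrow> real n \<le> exp (C' * sqrt (real m)) \<longrightarrow>
      measure_pmf.prob (bernoulli_mat q m n)
        {A. \<forall>S \<subseteq> {..<n}. card S = m \<longrightarrow>
              real (vec_space.rank m (column_submatrix A S)) > real m - C * ln (real n)}
        \<ge> 1 - exp (- (real m * ln (real n))) \<and>
      (n \<ge> m\<^sup>2 \<longrightarrow>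
        measure_pmf.prob (bernoulli_mat q m n)
          {A. \<exists>S \<subseteq> {..<n}. card S = m \<and>
                real (vec_space.rank m (column_submatrix A S)) \<le> real m - c0 * ln (real n)}
          \<ge> 1 - exp (- (c * real m))))"
proof -
  obtain c :: real and K M :: nat where c: "0 < c" and low: 
    "\<forall>m k. \<forall>S :: nat set. M \<le> m \<longrightarrow> K \<le> k \<longrightarrow> finite S \<longrightarrow> card S = m \<longrightarrow>
       prob (Pi_pmf S (\<lambda>_. 0) (\<lambda>_. random_vec m (bernoulli_int q))) {X. \<exists>J\<subseteq>S. card J + k \<le> m \<and> X ` S \<subseteq> cl m (X ` J)}
       \<le> 3 * exp (- c * k * m)"
    using prob_low_rank_le_exp[OF assms] by (elim exE conjE)
  define c0 where "c0 = 1 / (4 * - ln (1 - q))"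
  have c0: "0 < c0" using assms by (simp add: c0_def)
  \<comment> \<open>The term \<open>3 / c\<close> makes the failure probability of one
    \<open>S\<close> at most 3 n^(-3 m), of which the union over \<open>S\<close> consumes n^m. The
    term \<open>K / ln 2\<close> gives \<open>K \<le> k\<close> for all \<open>n \<ge> 2\<close>,
    and \<open>c0 + 1\<close> gives \<open>c0 < C\<close>.\<close>
  define C where "C = 3 / c + K / ln 2 + c0 + 1"
  have ln2: "0 < ln (2::real)" by simp
  have C: "c0 < C" "3 \<le> c * C" "K \<le> C * ln 2" "0 < C"
  proof -
    have "3 / c \<le> C" "K / ln 2 \<le> C" using c c0 by (auto simp: C_def)
    then show "3 \<le> c * C" "K \<le> C * ln 2" using c by (simp_all add: field_simps)
    have "0 \<le> 3 / c" "0 \<le> K / ln 2" using c by auto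
    then show "c0 < C" "0 < C" using c0 unfolding C_def by linarith+
  qed
  define B where "B = max (real (max M 2)) (exp (128 / (1 - q)))"
  have B: "M \<le> B" "2 \<le> B" "exp (128 / (1 - q)) \<le> B" by (auto simp: B_def)
  \<comment> \<open>For \<open>n \<ge> 2\<close> the upper bound on \<open>n\<close> now forces
    \<open>B \<le> m\<close>, so that \<open>m\<close> is large enough throughout. The second entry
    keeps c0 ln n at most m / 2, so that the zero block fits into \<open>m\<close> rows.\<close>
  define C' where "C' = min (ln 2 / sqrt B) (1 / (2 * c0))"
  have C': "0 < C'" "C' \<le> ln 2 / sqrt B" "C' \<le> 1 / (2 * c0)" using B c0 by (auto simp: C'_def)
  have ln_n: "ln (real n) \<le> C' * sqrt m" if "2 \<le> n" "real n \<le> exp (C' * sqrt (real m))" for m n :: nat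
  proof -
    have "ln (real n) \<le> ln (exp (C' * sqrt (real m)))"
      using that by (subst ln_le_cancel_iff) auto
    then show ?thesis by simp
  qed
  have large: "B \<le> m" "2 \<le> m" "M \<le> m" if "2 \<le> n" "real n \<le> exp (C' * sqrt (real m))" for m n
  proof -
    have "ln 2 \<le> ln (real n)" using that by simp
    also have "\<dots> \<le> C' * sqrt m" by (rule ln_n) fact+
    also have "\<dots> \<le> ln 2 / sqrt B * sqrt m" using C' by (intro mult_right_mono) auto
    finally have "sqrt B \<le> sqrt m" using B ln2 by (simp add: field_simps)
    then show "B \<le> m" by simp
    then show "2 \<le> m" "M \<le> m" using B by linarith+
  qed
  show ?thesis
  \<comment> \<open>The decay rate in the second estimate can be taken to be 1.\<close>
  proof (rule exI[of _ C'], rule exI[of _ C], rule exI[of _ c0], rule exI[of _ 1], intro conjI allI impI)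
    fix m n :: nat
    assume mn: "1 \<le> m" "m \<le> n" "real n \<le> exp (C' * sqrt (real m))"
    let ?Q = "Pi_pmf {..<n} (\<lambda>_. 0) (\<lambda>_. random_vec m (bernoulli_int q))"
    let ?M = "\<lambda>x. mat m n (\<lambda>(i, j). real_of_int (x j i))"
    let ?rk = "\<lambda>A S. vec_space.rank m (column_submatrix A S)"
    define L where "L = ln (real n)"
    show "1 - exp (- (real m * ln (real n))) \<le> prob (bernoulli_mat q m n)
        {A. \<forall>S \<subseteq> {..<n}. card S = m \<longrightarrow> real (?rk A S) > real m - C * ln (real n)}" (is "_ \<le> prob _ ?G")
    \<comment> \<open>For \<open>n = 1\<close> the logarithm vanishes and the claimed lower bound is
      0.\<close>
    proof (cases "n = 1")
      case False
      then have n2: "2 \<le> n" using mn by linarith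
      note m = large[OF n2 mn(3)]
      have L: "ln 2 \<le> L" "exp L = n" using n2 by (auto simp: L_def)
      then have L0: "0 \<le> L" using ln2 by linarith
      \<comment> \<open>Ranks are integers, so a rank of at most m - C L is already at most m -
        k.\<close>
      define k where "k = nat \<lceil>C * L\<rceil>"
      have "C * ln 2 \<le> C * L" using L C by (intro mult_left_mono) auto
      then have k: "C * L \<le> k" "K \<le> k" using C(3) by (auto simp: k_def le_nat_iff) linarith+
      let ?bad = "\<lambda>S. {x. \<exists>J\<subseteq>S. card J + k \<le> m \<and> x ` S \<subseteq> cl m (x ` J)}"
      let ?\<S> = "{S. S \<subseteq> {..<n} \<and> card S = m}"
      have "prob (bernoulli_mat q m n) (- ?G) = prob ?Q (?M -` (- ?G))"
        by (simp add: bernoulli_mat_columns)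
      also have "\<dots> \<le> prob ?Q (\<Union>S\<in>?\<S>. ?bad S)"
      proof (intro measure_pmf.finite_measure_mono subsetI)
        fix x assume "x \<in> ?M -` (- ?G)"
        then obtain S where S: "S \<subseteq> {..<n}" "card S = m" "real (?rk (?M x) S) \<le> m - C * L"
          by (auto simp: L_def not_less)
        then have "C * L \<le> of_int (int m - int (?rk (?M x) S))" by simp
        then have "\<lceil>C * L\<rceil> \<le> int m - int (?rk (?M x) S)" by (simp only: ceiling_le_iff)
        moreover have "0 \<le> C * L" using C(4) L0 by simp
        then have "int k = \<lceil>C * L\<rceil>" by (simp add: k_def)
        ultimately have "?rk (?M x) S + k \<le> m" by linarith
        from span_basis_of_low_rank[OF S(1,2) this] S(1,2)
        show "x \<in> (\<Union>S\<in>?\<S>. ?bad S)" by blast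
      qed auto
      also have "\<dots> \<le> (\<Sum>S\<in>?\<S>. prob ?Q (?bad S))"
        by (intro measure_pmf.finite_measure_subadditive_finite) auto
      also have "\<dots> \<le> (\<Sum>S\<in>?\<S>. 3 * exp (- c * k * m))"
      proof (rule sum_mono)
        fix S assume "S \<in> ?\<S>"
        then have S: "S \<subseteq> {..<n}" "card S = m" by auto
        have "prob ?Q (?bad S) = prob (Pi_pmf S (\<lambda>_. 0) (\<lambda>_. random_vec m (bernoulli_int q))) (?bad S)"
        proof (rule prob_Pi_pmf_local)
          fix h h' :: "nat \<Rightarrow> nat \<Rightarrow> int" assume "\<And>x. x \<in> S \<Longrightarrow> h x = h' x"
          then have im: "h ` J = h' ` J" if "J \<subseteq> S" for J using that by (intro image_cong) auto
          then show "(\<exists>J\<subseteq>S. card J + k \<le> m \<and> h ` S \<subseteq> cl m (h ` J)) =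
              (\<exists>J\<subseteq>S. card J + k \<le> m \<and> h' ` S \<subseteq> cl m (h' ` J))"
            by (intro ex_cong1 conj_cong refl) (simp add: im)
        qed (use S in auto)
        also have "\<dots> \<le> 3 * exp (- c * k * m)"
          using S finite_subset[OF S(1)] m k by (intro low[rule_format]) auto
        finally show "prob ?Q (?bad S) \<le> 3 * exp (- c * k * m)" .
      qed
      also have "\<dots> = card ?\<S> * (3 * exp (- c * k * m))" by simp
      also have "\<dots> \<le> exp L ^ m * (3 * exp (- (3 * (m * L))))"
      proof (rule mult_mono)
        have "real (card ?\<S>) \<le> real (n ^ m)" using card_subsets_le by (rule of_nat_mono)
        then show "real (card ?\<S>) \<le> exp L ^ m" by (simp add: L)
        have "3 * L \<le> c * C * L" using C(2) L0 by (intro mult_right_mono)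
        also have "\<dots> \<le> c * k" using k(1) c by (simp add: mult.assoc)
        finally have "3 * L * m \<le> c * k * m" by (intro mult_right_mono) auto
        then show "3 * exp (- c * k * m) \<le> 3 * exp (- (3 * (m * L)))" by (simp add: algebra_simps)
      qed auto
      also have "\<dots> = 3 * exp (- (m * L)) * exp (- (m * L))"
        by (simp flip: exp_of_nat_mult exp_add add: algebra_simps)
      also have "\<dots> \<le> 1 * exp (- (m * L))"
      proof (rule mult_right_mono)
        \<comment> \<open>From \<open>m \<ge> 2\<close> and \<open>L \<ge> ln 2\<close> it follows
          that n^m \<ge> 4, which absorbs the constant 3.\<close>
        have "4 = exp (2 * ln (2::real))" by (simp add: exp_double)
        also have "\<dots> \<le> exp (m * L)" using m(2) L ln2 by (subst exp_le_cancel_iff, intro mult_mono) auto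
        finally have "4 \<le> exp (m * L)" .
        then show "3 * exp (- (m * L)) \<le> 1" by (simp add: exp_minus field_simps)
      qed simp
      finally have "prob (bernoulli_mat q m n) (- ?G) \<le> exp (- (m * L))" by simp
      then show ?thesis
        using measure_pmf.prob_compl[of ?G "bernoulli_mat q m n"] by (simp add: Compl_eq_Diff_UNIV L_def)
    qed simp
    show "1 - exp (- (1 * real m)) \<le> prob (bernoulli_mat q m n)
        {A. \<exists>S \<subseteq> {..<n}. card S = m \<and> real (?rk A S) \<le> real m - c0 * ln (real n)}" (is "_ \<le> prob _ ?G")
      if sq: "m\<^sup>2 \<le> n"
    proof -
      define l where "l = nat \<lceil>c0 * L\<rceil>"
      have L0: "0 \<le> L" using mn by (simp add: L_def)
      have l: "c0 * L \<le> l" "real l \<le> c0 * L + 1"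
        using c0 L0 by (auto simp: l_def) 
      have G: "?M x \<in> ?G" if "\<exists>S\<subseteq>{..<n}. card S = m \<and> (\<forall>j\<in>S. \<forall>i<l. x j i = 0)" "l \<le> m" for x
      proof -
        from that obtain S where S: "S \<subseteq> {..<n}" "card S = m" "\<And>j i. j \<in> S \<Longrightarrow> i < l \<Longrightarrow> x j i = 0" by blast
        have "?rk (?M x) S \<le> m - l" using rank_zero_block_le[OF S(1) that(2), of x] S(3) by blast
        then have "real (?rk (?M x) S) \<le> real m - c0 * L" using that(2) l(1) by linarith
        then show ?thesis using S(1,2) by (auto simp: L_def)
      qed
      have red: "prob ?Q {x. \<exists>S\<subseteq>{..<n}. card S = m \<and> (\<forall>j\<in>S. \<forall>i<l. x j i = 0)} \<le> prob (bernoulli_mat q m n) ?G" if "l \<le> m"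
      proof -
        have "prob (bernoulli_mat q m n) ?G = prob ?Q (?M -` ?G)" by (simp add: bernoulli_mat_columns)
        moreover have "prob ?Q {x. \<exists>S\<subseteq>{..<n}. card S = m \<and> (\<forall>j\<in>S. \<forall>i<l. x j i = 0)} \<le> prob ?Q (?M -` ?G)"
          using G that by (intro measure_pmf.finite_measure_mono subsetI) (auto simp del: mem_Collect_eq dest!: CollectD)
        ultimately show ?thesis by simp
      qed
      show ?thesis
      proof (cases "n = 1")
        case True
        \<comment> \<open>The block of zeros is empty here, so \<open>S = {0}\<close> qualifies for
          every outcome.\<close>
        then have "l = 0" "m = 1" using mn by (auto simp: l_def L_def)
        have "{x. \<exists>S\<subseteq>{..<n}. card S = m \<and> (\<forall>j\<in>S. \<forall>i<l. x j i = (0::int))} = UNIV"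
          using True \<open>l = 0\<close> \<open>m = 1\<close> by (auto intro!: exI[of _ "{0}"])
        then have "1 \<le> prob (bernoulli_mat q m n) ?G" using red \<open>l = 0\<close> by simp
        then show ?thesis using exp_ge_zero[of "- (1 * real m)"] by linarith
      next
        case False
        then have n2: "2 \<le> n" using mn by linarith
        note m = large[OF n2 mn(3)]
        have "exp (128 / (1 - q)) \<le> n" using B(3) m(1) mn(2) by linarith
        then have "128 / (1 - q) \<le> L" unfolding L_def using n2 by (subst ln_ge_iff) auto
        have "L \<le> C' * sqrt m" unfolding L_def by (rule ln_n) fact+
        also have "\<dots> \<le> 1 / (2 * c0) * m"
        proof (rule mult_mono)
          have "sqrt m \<le> sqrt (m * m)" using mn(1) by (intro real_sqrt_le_mono) simp
          then show "sqrt m \<le> m" by simp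
        qed (use C' c0 in auto)
        finally have "c0 * L \<le> m / 2" using c0 by (simp add: field_simps)
        then have lm: "l \<le> m" using l(2) m(2) by linarith
        have "real (n ^ m) * (1 - (1 - q) ^ l) ^ (n - m) \<le> exp (- real m)"
          using zero_block_failure_le[OF assms c0_def sq m(2)] \<open>128 / (1 - q) \<le> L\<close> l(2) by (simp add: L_def)
        then show ?thesis using prob_zero_block_ge[OF assms lm mn(2)] red[OF lm] by simp
      qed
    qed
  qed (use C'(1) C(1) c0 in auto)
qed

end
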